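(* Let $G=\mathbb{R}\times\mathbb{R}^+=\{(x,y)\in\mathbb{R}^2 : y>0\}$ be the set of all normal distributions, where $(x,y)=(\mu,\sigma)$ corresponds to the normal distribution with mean $\mu$ and variance $\sigma^2$, with its standard smooth structure. Then $G$ admits a Lie group structure such that the Fisher metric $g^F=(dx^2+2\,dy^2)/y^2$ is left-invariant and such that, furthermore, with respect to this Lie group structure, for every affine connection $\nabla$ on $G$ for which $(G,g^F,\nabla)$ is a statistical Lie group, the following statements are mutually equivalent: (1) $\nabla$ is the Amari--Chentsov $\alpha$-connection, i.e. $\nabla=\nabla^{(\alpha)}$ for some $\alpha\in\mathbb{R}$; (2) $\nabla^{g^F} C$ is totally symmetric; (3) $\nabla C$ is totally symmetric; (4) $\nabla^{g^F} K$ is totally symmetric; (5) $R=R^*$. Here $C$ and $K$ are the cubic form and skewness operator of $(G,g^F,\nabla)$, and $R$, $R^*$ are the curvature tensor fields of $\nabla$ and of its dual connection $\nabla^*$.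
   Context: A torsion-free affine connection $\nabla$ on a Riemannian manifold $(M,g)$ is compatible with $g$ if $\nabla g$ is totally symmetric; then $(g,\nabla)$ is called a statistical structure on $M$. A statistical Lie group $(G,g,\nabla)$ is a Lie group $G$ with a statistical structure $(g,\nabla)$ such that both $g$ and $\nabla$ are invariant under left translations. $\nabla^{g}$ denotes the Levi-Civita connection of $g$. For a statistical structure $(g,\nabla)$: - the cubic form is the symmetric $(0,3)$-tensor field $C(X,Y,Z)=(\nabla_X g)(Y,Z)$; - the skewness operator is the $(1,2)$-tensor field $K$ defined by $g(K(X,Y),Z)=C(X,Y,Z)$, so that $\nabla=\nabla^g-\frac12 K$; - the dual (conjugate) connection $\nabla^*$ is defined by $X g(Y,Z)=g(\nabla_XY,Z)+g(Y,\nabla^*_XZ)$ for all vector fields $X,Y,Z$. "$\nabla^{g}C$ (resp. $\nabla C$) is totally symmetric" means that the $(0,4)$-tensor $(X,Y,Z,W)\mapsto(\nabla^g_XC)(Y,Z,W)$ (resp. $(\nabla_XC)(Y,Z,W)$) is symmetric in all arguments; "$\nabla^gK$ is totally symmetric" means that $(\nabla^g_XK)(Y,Z)$ is symmetric in $X,Y,Z$. The Fisher metric and the Amari--Chentsov $\alpha$-connection ($\alpha\in\mathbb{R}$) of the space of normal distributions are defined as follows. Let $p(t,\theta)=\frac{1}{\sqrt{2\pi\sigma^2}}\exp\{-\frac{(t-\mu)^2}{2\sigma^2}\}$, $\theta=(\mu,\sigma)$, and $E_\theta[f]=\int_{\mathbb{R}}f(t)p(t,\theta)\,dt$. Put $g^F(X,Y)=E_\theta[(X\log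 p)(Y\log p)]$ and $C^F(X,Y,Z)=E_\theta[(X\log p)(Y\log p)(Z\log p)]$, and define $\nabla^{(\alpha)}$ by $g^F(\nabla^{(\alpha)}_XY,Z)=g^F(\nabla^{g^F}_XY,Z)-\frac{\alpha}{2}C^F(X,Y,Z)$. Explicitly, in coordinates $(x,y)=(\mu,\sigma)$, $g^F=(dx^2+2dy^2)/y^2$ and $$\nabla^{(\alpha)}_{\partial_x}\partial_x=\frac{1-\alpha}{2y}\partial_y,\quad \nabla^{(\alpha)}_{\partial_x}\partial_y=\nabla^{(\alpha)}_{\partial_y}\partial_x=-\frac{1+\alpha}{y}\partial_x,\quad \nabla^{(\alpha)}_{\partial_y}\partial_y=-\frac{1+2\alpha}{y}\partial_y.$$ *)

theory Defs
  imports "HOL-Probability.Probability" "HOL-Algebra.Group"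
begin

text \<open>
  All manifolds are open subsets \<open>U\<close> of a Euclidean space with the standard smooth structure,
  every tangent space being identified with the ambient space. A function on \<open>U\<close> is a total
  function whose values outside \<open>U\<close> are irrelevant; every identity between fields is required
  only at the points of \<open>U\<close>.
\<close>

fun times_cont_diff_on :: "nat \<Rightarrow> 'a::euclidean_space set \<Rightarrow> ('a \<Rightarrow> 'b::euclidean_space) \<Rightarrow> bool" where
  "times_cont_diff_on 0 U f \<longleftrightarrow> continuous_on U f"
| "times_cont_diff_on (Suc n) U f \<longleftrightarrow>
     (\<forall>x\<in>U. f differentiable (at x)) \<and>
     (\<forall>v. times_cont_diff_on n U (\<lambda>x. frechet_derivative f (at x) v))"

text \<open>Only meant for open \<open>U\<close>, since derivatives are taken with respect to the full filter.\<close>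

definition smooth_on :: "'a::euclidean_space set \<Rightarrow> ('a \<Rightarrow> 'b::euclidean_space) \<Rightarrow> bool" where
  "smooth_on U f \<longleftrightarrow> (\<forall>n. times_cont_diff_on n U f)"

type_synonym 'a vfield = "'a \<Rightarrow> 'a"
type_synonym 'a metric_field = "'a \<Rightarrow> 'a \<Rightarrow> 'a \<Rightarrow> real"
type_synonym 'a connection = "'a vfield \<Rightarrow> 'a vfield \<Rightarrow> 'a vfield"

definition vector_fields :: "'a::euclidean_space set \<Rightarrow> 'a vfield set" where
  "vector_fields U = {X. smooth_on U X}"

definition along :: "'a::euclidean_space vfield \<Rightarrow> ('a \<Rightarrow> real) \<Rightarrow> 'a \<Rightarrow> real" where
  "along X f p = frechet_derivative f (at p) (X p)"

definition lie_bracket :: "'a::euclidean_space vfield \<Rightarrow> 'a vfield \<Rightarrow> 'a vfield" where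
  "lie_bracket X Y p = frechet_derivative Y (at p) (X p) - frechet_derivative X (at p) (Y p)"

definition riemannian_metric :: "'a::euclidean_space set \<Rightarrow> 'a metric_field \<Rightarrow> bool" where
  "riemannian_metric U g \<longleftrightarrow>
     (\<forall>p\<in>U. bilinear (g p) \<and> (\<forall>u v. g p u v = g p v u) \<and> (\<forall>u. u \<noteq> 0 \<longrightarrow> g p u u > 0)) \<and>
     (\<forall>u v. smooth_on U (\<lambda>p. g p u v))"

definition metric_app :: "'a metric_field \<Rightarrow> 'a vfield \<Rightarrow> 'a vfield \<Rightarrow> 'a \<Rightarrow> real" where
  "metric_app g X Y p = g p (X p) (Y p)"

text \<open>
  The values of a connection on arguments that are not smooth on \<open>U\<close> are unconstrained. That
  \<open>nab X Y\<close> on \<open>U\<close> depends only on \<open>X\<close> and \<open>Y\<close> on \<open>U\<close> follows from the axioms: a field \<open>D\<close>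
  vanishing on \<open>U\<close> satisfies \<open>D = f D\<close> for the indicator \<open>f\<close> of the complement of \<open>U\<close>.
\<close>

definition affine_connection :: "'a::euclidean_space set \<Rightarrow> 'a connection \<Rightarrow> bool" where
  "affine_connection U nab \<longleftrightarrow>
     (\<forall>X\<in>vector_fields U. \<forall>Y\<in>vector_fields U. nab X Y \<in> vector_fields U) \<and>
     (\<forall>X\<in>vector_fields U. \<forall>X'\<in>vector_fields U. \<forall>Y\<in>vector_fields U. \<forall>p\<in>U.
        nab (\<lambda>q. X q + X' q) Y p = nab X Y p + nab X' Y p) \<and>
     (\<forall>X\<in>vector_fields U. \<forall>Y\<in>vector_fields U. \<forall>Y'\<in>vector_fields U. \<forall>p\<in>U.
        nab X (\<lambda>q. Y q + Y' q) p = nab X Y p + nab X Y' p) \<and>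
     (\<forall>f. smooth_on U f \<longrightarrow> (\<forall>X\<in>vector_fields U. \<forall>Y\<in>vector_fields U. \<forall>p\<in>U.
        nab (\<lambda>q. f q *\<^sub>R X q) Y p = f p *\<^sub>R nab X Y p)) \<and>
     (\<forall>f. smooth_on U f \<longrightarrow> (\<forall>X\<in>vector_fields U. \<forall>Y\<in>vector_fields U. \<forall>p\<in>U.
        nab X (\<lambda>q. f q *\<^sub>R Y q) p = f p *\<^sub>R nab X Y p + along X f p *\<^sub>R Y p))"

definition torsion_free :: "'a::euclidean_space set \<Rightarrow> 'a connection \<Rightarrow> bool" where
  "torsion_free U nab \<longleftrightarrow>
     (\<forall>X\<in>vector_fields U. \<forall>Y\<in>vector_fields U. \<forall>p\<in>U.
        nab X Y p - nab Y X p = lie_bracket X Y p)"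

definition curvature :: "'a::euclidean_space connection \<Rightarrow> 'a vfield \<Rightarrow> 'a vfield \<Rightarrow> 'a vfield \<Rightarrow> 'a vfield"
  where
  "curvature nab X Y Z p = nab X (nab Y Z) p - nab Y (nab X Z) p - nab (lie_bracket X Y) Z p"

text \<open>\<open>cubic_form g nab X Y Z\<close> is \<open>(\<nabla>\<^sub>X g)(Y, Z)\<close>.\<close>

definition cubic_form ::
  "'a::euclidean_space metric_field \<Rightarrow> 'a connection \<Rightarrow> 'a vfield \<Rightarrow> 'a vfield \<Rightarrow> 'a vfield \<Rightarrow> 'a \<Rightarrow> real"
  where
  "cubic_form g nab X Y Z p =
     along X (metric_app g Y Z) p - metric_app g (nab X Y) Z p - metric_app g Y (nab X Z) p"

definition levi_civita_connection ::
  "'a::euclidean_space set \<Rightarrow> 'a metric_field \<Rightarrow> 'a connection \<Rightarrow> bool" where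
  "levi_civita_connection U g nab \<longleftrightarrow>
     affine_connection U nab \<and> torsion_free U nab \<and>
     (\<forall>X\<in>vector_fields U. \<forall>Y\<in>vector_fields U. \<forall>Z\<in>vector_fields U. \<forall>p\<in>U.
        cubic_form g nab X Y Z p = 0)"

text \<open>
  The choice is harmless: on smooth fields and at points of \<open>U\<close>, the values of a Levi-Civita
  connection are uniquely determined.
\<close>

definition levi_civita :: "'a::euclidean_space set \<Rightarrow> 'a metric_field \<Rightarrow> 'a connection" where
  "levi_civita U g = (SOME nab. levi_civita_connection U g nab)"

text \<open>The two transpositions, respectively the three, generate the full symmetric group.\<close>

definition totally_symmetric3 ::
  "'a::euclidean_space set \<Rightarrow> ('a vfield \<Rightarrow> 'a vfield \<Rightarrow> 'a vfield \<Rightarrow> 'a \<Rightarrow> 'b) \<Rightarrow> bool" where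
  "totally_symmetric3 U T \<longleftrightarrow>
     (\<forall>X\<in>vector_fields U. \<forall>Y\<in>vector_fields U. \<forall>Z\<in>vector_fields U. \<forall>p\<in>U.
        T X Y Z p = T Y X Z p \<and> T X Y Z p = T X Z Y p)"

definition totally_symmetric4 ::
  "'a::euclidean_space set \<Rightarrow>
     ('a vfield \<Rightarrow> 'a vfield \<Rightarrow> 'a vfield \<Rightarrow> 'a vfield \<Rightarrow> 'a \<Rightarrow> 'b) \<Rightarrow> bool" where
  "totally_symmetric4 U T \<longleftrightarrow>
     (\<forall>X\<in>vector_fields U. \<forall>Y\<in>vector_fields U. \<forall>Z\<in>vector_fields U. \<forall>W\<in>vector_fields U. \<forall>p\<in>U.
        T X Y Z W p = T Y X Z W p \<and> T X Y Z W p = T X Z Y W p \<and> T X Y Z W p = T X Y W Z p)"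

definition statistical_structure ::
  "'a::euclidean_space set \<Rightarrow> 'a metric_field \<Rightarrow> 'a connection \<Rightarrow> bool" where
  "statistical_structure U g nab \<longleftrightarrow>
     riemannian_metric U g \<and> affine_connection U nab \<and> torsion_free U nab \<and>
     totally_symmetric3 U (cubic_form g nab)"

definition skewness ::
  "'a::euclidean_space set \<Rightarrow> 'a metric_field \<Rightarrow> 'a connection \<Rightarrow> 'a vfield \<Rightarrow> 'a vfield \<Rightarrow> 'a vfield"
  where
  "skewness U g nab X Y p =
     (THE k. \<forall>Z\<in>vector_fields U. g p k (Z p) = cubic_form g nab X Y Z p)"

definition dual_connection ::
  "'a::euclidean_space set \<Rightarrow> 'a metric_field \<Rightarrow> 'a connection \<Rightarrow> 'a connection" where
  "dual_connection U g nab X Z p =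
     (THE w. \<forall>Y\<in>vector_fields U.
        along X (metric_app g Y Z) p = metric_app g (nab X Y) Z p + g p (Y p) w)"

text \<open>The first field argument after the tensor is the direction of differentiation.\<close>

definition cov_deriv_03 ::
  "'a::euclidean_space connection \<Rightarrow> ('a vfield \<Rightarrow> 'a vfield \<Rightarrow> 'a vfield \<Rightarrow> 'a \<Rightarrow> real) \<Rightarrow>
     'a vfield \<Rightarrow> 'a vfield \<Rightarrow> 'a vfield \<Rightarrow> 'a vfield \<Rightarrow> 'a \<Rightarrow> real" where
  "cov_deriv_03 nab T X Y Z W p =
     along X (T Y Z W) p - T (nab X Y) Z W p - T Y (nab X Z) W p - T Y Z (nab X W) p"

definition cov_deriv_12 ::
  "'a::euclidean_space connection \<Rightarrow> ('a vfield \<Rightarrow> 'a vfield \<Rightarrow> 'a vfield) \<Rightarrow>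
     'a vfield \<Rightarrow> 'a vfield \<Rightarrow> 'a vfield \<Rightarrow> 'a vfield" where
  "cov_deriv_12 nab T X Y Z p =
     nab X (T Y Z) p - T (nab X Y) Z p - T Y (nab X Z) p"

definition lie_group :: "'a::euclidean_space monoid \<Rightarrow> bool" where
  "lie_group H \<longleftrightarrow>
     group H \<and> open (carrier H) \<and>
     smooth_on (carrier H \<times> carrier H) (\<lambda>(a, b). a \<otimes>\<^bsub>H\<^esub> b) \<and>
     smooth_on (carrier H) (\<lambda>a. inv\<^bsub>H\<^esub> a)"

definition left_diff :: "'a::euclidean_space monoid \<Rightarrow> 'a \<Rightarrow> 'a \<Rightarrow> 'a \<Rightarrow> 'a" where
  "left_diff H a p = frechet_derivative (\<lambda>x. a \<otimes>\<^bsub>H\<^esub> x) (at p)"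

definition left_push :: "'a::euclidean_space monoid \<Rightarrow> 'a \<Rightarrow> 'a vfield \<Rightarrow> 'a vfield" where
  "left_push H a X q = left_diff H a (inv\<^bsub>H\<^esub> a \<otimes>\<^bsub>H\<^esub> q) (X (inv\<^bsub>H\<^esub> a \<otimes>\<^bsub>H\<^esub> q))"

definition left_invariant_metric :: "'a::euclidean_space monoid \<Rightarrow> 'a metric_field \<Rightarrow> bool" where
  "left_invariant_metric H g \<longleftrightarrow>
     (\<forall>a\<in>carrier H. \<forall>p\<in>carrier H. \<forall>u v.
        g (a \<otimes>\<^bsub>H\<^esub> p) (left_diff H a p u) (left_diff H a p v) = g p u v)"

definition left_invariant_connection :: "'a::euclidean_space monoid \<Rightarrow> 'a connection \<Rightarrow> bool" where
  "left_invariant_connection H nab \<longleftrightarrow>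
     (\<forall>a\<in>carrier H. \<forall>X\<in>vector_fields (carrier H). \<forall>Y\<in>vector_fields (carrier H). \<forall>q\<in>carrier H.
        nab (left_push H a X) (left_push H a Y) q = left_push H a (nab X Y) q)"

definition statistical_lie_group ::
  "'a::euclidean_space monoid \<Rightarrow> 'a metric_field \<Rightarrow> 'a connection \<Rightarrow> bool" where
  "statistical_lie_group H g nab \<longleftrightarrow>
     lie_group H \<and> statistical_structure (carrier H) g nab \<and>
     left_invariant_metric H g \<and> left_invariant_connection H nab"

text \<open>Points are pairs of mean and standard deviation.\<close>

definition normal_family :: "(real \<times> real) set" where
  "normal_family = {(x, y). y > 0}"

definition normal_expectation :: "real \<times> real \<Rightarrow> (real \<Rightarrow> real) \<Rightarrow> real" where
  "normal_expectation \<theta> f = (\<integral>t. f t * normal_density (fst \<theta>) (snd \<theta>) t \<partial>lborel)"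

definition score :: "real \<times> real \<Rightarrow> real \<times> real \<Rightarrow> real \<Rightarrow> real" where
  "score \<theta> u t =
     frechet_derivative (\<lambda>\<eta>. ln (normal_density (fst \<eta>) (snd \<eta>) t)) (at \<theta>) u"

definition fisher_metric :: "(real \<times> real) metric_field" where
  "fisher_metric \<theta> u v = normal_expectation \<theta> (\<lambda>t. score \<theta> u t * score \<theta> v t)"

definition fisher_cubic :: "real \<times> real \<Rightarrow> real \<times> real \<Rightarrow> real \<times> real \<Rightarrow> real \<times> real \<Rightarrow> real" where
  "fisher_cubic \<theta> u v w =
     normal_expectation \<theta> (\<lambda>t. score \<theta> u t * score \<theta> v t * score \<theta> w t)"

definition amari_chentsov :: "real \<Rightarrow> (real \<times> real) connection" where
  "amari_chentsov \<alpha> X Y p =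
     (THE w. \<forall>v. fisher_metric p w v =
        fisher_metric p (levi_civita normal_family fisher_metric X Y p) v
          - \<alpha> / 2 * fisher_cubic p (X p) (Y p) v)"

end

theory Submission
  imports Defs
begin

text \<open>
  The Lie group is the affine group \<open>(a, b)(x, y) = (a + b x, b y)\<close>, whose left translations have
  the differential \<open>b\<close> times the identity. Hence a left-invariant connection has Christoffel symbols
  \<open>\<gamma> / y\<close> with constant \<open>\<gamma>\<close>. For a statistical structure, \<open>\<gamma>\<close> is determined by the four
  components \<open>a = C\<^sub>1\<^sub>1\<^sub>1\<close>, \<open>b = C\<^sub>1\<^sub>1\<^sub>2\<close>, \<open>c = C\<^sub>1\<^sub>2\<^sub>2\<close>, \<open>d = C\<^sub>2\<^sub>2\<^sub>2\<close> of the cubic form in the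
  left-invariant frame \<open>y\<partial>\<^sub>x\<close>, \<open>y\<partial>\<^sub>y\<close>, and the Levi-Civita connection, the dual connection and
  the Amari--Chentsov connections belong to \<open>(0, 0, 0, 0)\<close>, \<open>(-a, -b, -c, -d)\<close> and
  \<open>(0, 2\<alpha>, 0, 8\<alpha>)\<close>. Each of the five statements then becomes a polynomial condition that is
  equivalent to \<open>a = 0\<close>, \<open>c = 0\<close>, \<open>d = 4 b\<close>.
\<close>

subsection \<open>Smooth maps on open sets\<close>

text \<open>\<open>frechet_derivative\<close> is a choice among all derivatives at the point.
  Functions that agree near the point have the same derivatives there, so the chosen values agree
  even where no derivative exists.\<close>

lemma frechet_derivative_cong_open:
  assumes "open U" "x \<in> U" "\<And>y. y \<in> U \<Longrightarrow> f y = g y"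
  shows "frechet_derivative f (at x) = frechet_derivative g (at x)"
proof -
  have "(f has_derivative D) (at x) \<longleftrightarrow> (g has_derivative D) (at x)" for D
    using has_derivative_transform_within_open[OF _ assms(1,2), of f D UNIV g]
      has_derivative_transform_within_open[OF _ assms(1,2), of g D UNIV f] assms(3) by auto
  then show ?thesis
    unfolding frechet_derivative_def by simp
qed

lemma times_cont_diff_on_cong:
  assumes "open U" "\<And>x. x \<in> U \<Longrightarrow> f x = g x"
  shows "times_cont_diff_on n U f \<longleftrightarrow> times_cont_diff_on n U g"
  using assms(2)
proof (induction n arbitrary: f g)
  case 0
  then show ?case by (auto cong: continuous_on_cong)
next
  case (Suc n)
  have 1: "f differentiable (at x) \<longleftrightarrow> g differentiable (at x)" if "x \<in> U" for x
    unfolding differentiable_def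
    using has_derivative_transform_within_open[OF _ assms(1) that, of f _ UNIV g]
      has_derivative_transform_within_open[OF _ assms(1) that, of g _ UNIV f] Suc.prems by auto
  have 2: "times_cont_diff_on n U (\<lambda>x. frechet_derivative f (at x) v) \<longleftrightarrow>
      times_cont_diff_on n U (\<lambda>x. frechet_derivative g (at x) v)" for v
    by (rule Suc.IH) (use frechet_derivative_cong_open[OF assms(1)] Suc.prems in metis)
  show ?case using 1 2 by simp
qed

lemma times_cont_diff_on_SucD: "times_cont_diff_on (Suc n) U f \<Longrightarrow> times_cont_diff_on n U f"
proof (induction n arbitrary: f)
  case 0
  then show ?case
    by (auto intro!: continuous_at_imp_continuous_on differentiable_imp_continuous_within)
next
  case (Suc n)
  have "times_cont_diff_on (Suc n) U (\<lambda>x. frechet_derivative f (at x) v)" for v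
    using Suc.prems times_cont_diff_on.simps(2)[of "Suc n" U f] by blast
  with Suc show ?case by auto
qed

text \<open>Lets a derivative found by the usual rules stand in for the choice term of the recursive
  definition.\<close>

lemma times_cont_diff_on_SucI:
  assumes "open U" "\<And>x. x \<in> U \<Longrightarrow> (f has_derivative D x) (at x)"
    and "\<And>v. times_cont_diff_on n U (\<lambda>x. D x v)"
  shows "times_cont_diff_on (Suc n) U f"
proof -
  have "frechet_derivative f (at x) = D x" if "x \<in> U" for x
    using frechet_derivative_at[OF assms(2)[OF that]] ..
  then have "times_cont_diff_on n U (\<lambda>x. frechet_derivative f (at x) v)" for v
    using assms(3) times_cont_diff_on_cong[OF assms(1), of "\<lambda>x. frechet_derivative f (at x) v" "\<lambda>x. D x v"]
    by simp
  then show ?thesis using assms(2) by (auto simp: differentiable_def)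
qed

lemma times_cont_diff_on_const: "open U \<Longrightarrow> times_cont_diff_on n U (\<lambda>x. c)"
  by (induction n arbitrary: c) (auto simp: frechet_derivative_const)

lemma times_cont_diff_on_add:
  "open U \<Longrightarrow> times_cont_diff_on n U f \<Longrightarrow> times_cont_diff_on n U g \<Longrightarrow>
    times_cont_diff_on n U (\<lambda>x. f x + g x)"
proof (induction n arbitrary: f g)
  case 0
  then show ?case by (auto intro: continuous_on_add)
next
  case (Suc n)
  show ?case
    by (rule times_cont_diff_on_SucI[where D="\<lambda>x v. frechet_derivative f (at x) v + frechet_derivative g (at x) v"])
      (use Suc in \<open>auto intro!: has_derivative_add simp: frechet_derivative_works\<close>)
qed

text \<open>By the product rule the derivative is a sum of values of \<open>B\<close> at pairs
  formed from \<open>f\<close>, \<open>g\<close> and their derivatives, so the induction closes.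
  Products, scalar multiples and linear images are instances.\<close>

lemma times_cont_diff_on_bilinear:
  assumes "bounded_bilinear B" "open U"
  shows "times_cont_diff_on n U f \<Longrightarrow> times_cont_diff_on n U g \<Longrightarrow>
    times_cont_diff_on n U (\<lambda>x. B (f x) (g x))"
proof (induction n arbitrary: f g)
  case 0
  then show ?case using bounded_bilinear.continuous_on[OF assms(1)] by auto
next
  case (Suc n)
  \<comment> \<open>The product rule keeps one factor undifferentiated, so each factor must also be
    known to order \<open>n\<close>.\<close>
  have "times_cont_diff_on n U f" "times_cont_diff_on n U g"
    using Suc.prems times_cont_diff_on_SucD by blast+
  with Suc show ?case
    by (intro times_cont_diff_on_SucI[where D="\<lambda>x v. B (f x) (frechet_derivative g (at x) v) +
          B (frechet_derivative f (at x) v) (g x)"] times_cont_diff_on_add)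
      (use assms in \<open>auto intro!: bounded_bilinear.FDERIV[OF assms(1)] simp: frechet_derivative_works[symmetric]\<close>)
qed

section \<open>Closure properties of smooth maps\<close>

lemma smooth_on_cong: "open U \<Longrightarrow> (\<And>x. x \<in> U \<Longrightarrow> f x = g x) \<Longrightarrow> smooth_on U f \<longleftrightarrow> smooth_on U g"
  unfolding smooth_on_def using times_cont_diff_on_cong by blast

lemma smooth_on_const: "open U \<Longrightarrow> smooth_on U (\<lambda>x. c)"
  by (simp add: smooth_on_def times_cont_diff_on_const)

lemma smooth_on_add: "open U \<Longrightarrow> smooth_on U f \<Longrightarrow> smooth_on U g \<Longrightarrow> smooth_on U (\<lambda>x. f x + g x)"
  by (simp add: smooth_on_def times_cont_diff_on_add)

lemma smooth_on_bilinear: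
  "bounded_bilinear B \<Longrightarrow> open U \<Longrightarrow> smooth_on U f \<Longrightarrow> smooth_on U g \<Longrightarrow>
    smooth_on U (\<lambda>x. B (f x) (g x))"
  by (simp add: smooth_on_def times_cont_diff_on_bilinear)

lemmas smooth_on_scaleR = smooth_on_bilinear[OF bounded_bilinear_scaleR]
lemmas smooth_on_mult = smooth_on_bilinear[OF bounded_bilinear_mult]

lemma smooth_on_linear:
  fixes L :: "'b::euclidean_space \<Rightarrow> 'c::euclidean_space"
  assumes "linear L" "open U" "smooth_on U f"
  shows "smooth_on U (\<lambda>x. L (f x))"
proof -
  \<comment> \<open>A linear map is a bilinear one whose first argument is held at the constant
    \<open>1\<close>.\<close>
  have "bounded_bilinear (\<lambda>(r::real) v. r *\<^sub>R L v)"
    using bounded_bilinear.comp[OF bounded_bilinear_scaleR bounded_linear_ident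
        linear_conv_bounded_linear[THEN iffD1, OF assms(1)]] .
  from smooth_on_bilinear[OF this assms(2) smooth_on_const[OF assms(2), of 1] assms(3)]
  show ?thesis by simp
qed

lemma smooth_on_id: "open U \<Longrightarrow> smooth_on U (\<lambda>x. x)"
proof -
  assume U: "open U"
  then have "times_cont_diff_on n U (\<lambda>x. x)" for n
    by (cases n) (auto simp: times_cont_diff_on_const)
  then show ?thesis by (simp add: smooth_on_def)
qed

lemma smooth_on_minus: "open U \<Longrightarrow> smooth_on U f \<Longrightarrow> smooth_on U (\<lambda>x. - f x)"
  by (rule smooth_on_linear) (auto intro: linearI)

lemma smooth_on_diff: "open U \<Longrightarrow> smooth_on U f \<Longrightarrow> smooth_on U g \<Longrightarrow> smooth_on U (\<lambda>x. f x - g x)"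
  using smooth_on_add[of U f "\<lambda>x. - g x"] smooth_on_minus[of U g] by simp

lemma smooth_on_fst: "open U \<Longrightarrow> smooth_on U f \<Longrightarrow> smooth_on U (\<lambda>x. fst (f x))"
  by (rule smooth_on_linear) (auto intro: linear_fst)

lemma smooth_on_snd: "open U \<Longrightarrow> smooth_on U f \<Longrightarrow> smooth_on U (\<lambda>x. snd (f x))"
  by (rule smooth_on_linear) (auto intro: linear_snd)

lemma smooth_on_inner: "open U \<Longrightarrow> smooth_on U f \<Longrightarrow> smooth_on U (\<lambda>x. f x \<bullet> c)"
  by (rule smooth_on_linear) (auto intro!: bounded_linear.linear bounded_linear_inner_left)

lemma smooth_on_Pair:
  assumes "open U" "smooth_on U f" "smooth_on U g"
  shows "smooth_on U (\<lambda>x. (f x, g x))"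
proof -
  have "smooth_on U (\<lambda>x. (f x, 0))" "smooth_on U (\<lambda>x. (0, g x))"
    by (rule smooth_on_linear; use assms in \<open>auto intro: linearI\<close>)+
  from smooth_on_add[OF assms(1) this] show ?thesis by simp
qed

lemma smooth_on_sum:
  "open U \<Longrightarrow> (\<And>i. i \<in> I \<Longrightarrow> smooth_on U (f i)) \<Longrightarrow> smooth_on U (\<lambda>x. \<Sum>i\<in>I. f i x)"
  by (induction I rule: infinite_finite_induct) (auto simp: smooth_on_const smooth_on_add)

lemma smooth_on_has_derivative:
  "smooth_on U f \<Longrightarrow> x \<in> U \<Longrightarrow> (f has_derivative frechet_derivative f (at x)) (at x)"
  unfolding smooth_on_def frechet_derivative_works[symmetric] by (metis times_cont_diff_on.simps(2))

lemma smooth_on_linear_derivative: "smooth_on U f \<Longrightarrow> x \<in> U \<Longrightarrow> linear (frechet_derivative f (at x))"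
  using smooth_on_has_derivative has_derivative_linear by blast

lemma smooth_on_frechet_derivative_const:
  "smooth_on U f \<Longrightarrow> smooth_on U (\<lambda>x. frechet_derivative f (at x) v)"
  unfolding smooth_on_def by (metis times_cont_diff_on.simps(2))

text \<open>Smoothness of \<open>f\<close> only speaks of derivatives in fixed directions. A
  variable direction is expanded in the basis, its coordinates being smooth coefficients.\<close>

lemma smooth_on_frechet_derivative:
  assumes "open U" "smooth_on U f" "smooth_on U X"
  shows "smooth_on U (\<lambda>x. frechet_derivative f (at x) (X x))"
proof -
  have "frechet_derivative f (at x) (X x) =
      (\<Sum>b\<in>Basis. (X x \<bullet> b) *\<^sub>R frechet_derivative f (at x) b)" if "x \<in> U" for x
    using smooth_on_linear_derivative[OF assms(2) that]
    by (subst (1) euclidean_representation[of "X x", symmetric]) (simp add: linear_sum linear_cmul del: euclidean_representation)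
  then show ?thesis
    by (subst smooth_on_cong[OF assms(1)], assumption)
      (intro smooth_on_sum smooth_on_scaleR smooth_on_inner smooth_on_frechet_derivative_const assms)
qed

text \<open>Induction on the order with \<open>f\<close> fixed: the derivative of
  \<open>1 / f\<close> is \<open>- f'\<close> times the square of \<open>1 / f\<close>, and the
  latter is covered by the induction hypothesis.\<close>

lemma smooth_on_inverse:
  fixes f :: "'a::euclidean_space \<Rightarrow> real"
  assumes "open U" "smooth_on U f" "\<And>x. x \<in> U \<Longrightarrow> f x \<noteq> 0"
  shows "smooth_on U (\<lambda>x. inverse (f x))"
proof -
  have "times_cont_diff_on n U (\<lambda>x. inverse (f x))" for n
  proof (induction n)
    case 0
    have "continuous_on U f" using assms(2) unfolding smooth_on_def by (metis times_cont_diff_on.simps(1))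
    then show ?case using assms(3) by (auto intro: continuous_on_inverse)
  next
    case (Suc n)
    have "times_cont_diff_on n U (\<lambda>x. - frechet_derivative f (at x) v)" for v
      using smooth_on_minus[OF assms(1) smooth_on_frechet_derivative_const[OF assms(2)]]
      by (simp add: smooth_on_def)
    then have *: "times_cont_diff_on n U (\<lambda>x. - frechet_derivative f (at x) v *
        (inverse (f x) * inverse (f x)))" for v
      by (intro times_cont_diff_on_bilinear[OF bounded_bilinear_mult assms(1)] Suc)
    show ?case
      by (rule times_cont_diff_on_SucI[OF assms(1) _ *])
        (use smooth_on_has_derivative[OF assms(2)] assms(3) in
          \<open>auto intro!: derivative_eq_intros simp: fun_eq_iff\<close>)
  qed
  then show ?thesis by (simp add: smooth_on_def)
qed

lemma smooth_on_divide:
  fixes f g :: "'a::euclidean_space \<Rightarrow> real"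
  assumes "open U" "smooth_on U f" "smooth_on U g" "\<And>x. x \<in> U \<Longrightarrow> g x \<noteq> 0"
  shows "smooth_on U (\<lambda>x. f x / g x)"
  unfolding divide_inverse by (intro smooth_on_mult smooth_on_inverse assms)

lemmas smooth_on_intros = smooth_on_const smooth_on_id smooth_on_add smooth_on_diff smooth_on_minus
  smooth_on_mult smooth_on_divide smooth_on_scaleR smooth_on_fst smooth_on_snd smooth_on_inner
  smooth_on_Pair smooth_on_inverse smooth_on_sum smooth_on_frechet_derivative

subsection \<open>Affine connections in flat coordinates\<close>

lemma vector_fields_iff: "X \<in> vector_fields U \<longleftrightarrow> smooth_on U X"
  by (simp add: vector_fields_def)

context
  fixes U :: "'a::euclidean_space set" and nab :: "'a connection"
  assumes U: "open U" and nab: "affine_connection U nab"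
begin

lemma affine_connection_add_left:
  "smooth_on U X \<Longrightarrow> smooth_on U X' \<Longrightarrow> smooth_on U Y \<Longrightarrow> p \<in> U \<Longrightarrow>
    nab (\<lambda>q. X q + X' q) Y p = nab X Y p + nab X' Y p"
  by (rule nab[unfolded affine_connection_def, THEN conjunct2, THEN conjunct1, rule_format]) (simp_all add: vector_fields_iff)

lemma affine_connection_add_right:
  "smooth_on U X \<Longrightarrow> smooth_on U Y \<Longrightarrow> smooth_on U Y' \<Longrightarrow> p \<in> U \<Longrightarrow>
    nab X (\<lambda>q. Y q + Y' q) p = nab X Y p + nab X Y' p"
  by (rule nab[unfolded affine_connection_def, THEN conjunct2, THEN conjunct2, THEN conjunct1, rule_format]) (simp_all add: vector_fields_iff)

lemma affine_connection_scaleR_left: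
  "smooth_on U f \<Longrightarrow> smooth_on U X \<Longrightarrow> smooth_on U Y \<Longrightarrow> p \<in> U \<Longrightarrow>
    nab (\<lambda>q. f q *\<^sub>R X q) Y p = f p *\<^sub>R nab X Y p"
  by (rule nab[unfolded affine_connection_def, THEN conjunct2, THEN conjunct2, THEN conjunct2, THEN conjunct1, rule_format]) (simp_all add: vector_fields_iff)

lemma affine_connection_scaleR_right:
  "smooth_on U f \<Longrightarrow> smooth_on U X \<Longrightarrow> smooth_on U Y \<Longrightarrow> p \<in> U \<Longrightarrow>
    nab X (\<lambda>q. f q *\<^sub>R Y q) p = f p *\<^sub>R nab X Y p + along X f p *\<^sub>R Y p"
  by (rule nab[unfolded affine_connection_def, THEN conjunct2, THEN conjunct2, THEN conjunct2, THEN conjunct2, rule_format]) (simp_all add: vector_fields_iff)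

lemma affine_connection_sum_left:
  assumes "finite S" "\<And>b. b \<in> S \<Longrightarrow> smooth_on U (f b)" "smooth_on U Y" "p \<in> U"
  shows "nab (\<lambda>q. \<Sum>b\<in>S. f b q *\<^sub>R V b) Y p = (\<Sum>b\<in>S. f b p *\<^sub>R nab (\<lambda>_. V b) Y p)"
  using assms
proof (induction S rule: finite_induct)
  case empty
  \<comment> \<open>The zero field is the zero function times itself, so homogeneity gives the empty
    sum.\<close>
  show ?case
    using affine_connection_scaleR_left[of "\<lambda>_. 0" "\<lambda>_. 0" Y p] empty U by (simp add: smooth_on_const)
next
  case (insert b S)
  then show ?case
    using affine_connection_add_left[of "\<lambda>q. f b q *\<^sub>R V b" "\<lambda>q. \<Sum>b\<in>S. f b q *\<^sub>R V b" Y p] U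
    by (simp add: affine_connection_scaleR_left smooth_on_intros)
qed

lemma affine_connection_sum_right:
  assumes "finite S" "\<And>b. b \<in> S \<Longrightarrow> smooth_on U (f b)" "smooth_on U X" "p \<in> U"
  shows "nab X (\<lambda>q. \<Sum>b\<in>S. f b q *\<^sub>R V b) p =
    (\<Sum>b\<in>S. f b p *\<^sub>R nab X (\<lambda>_. V b) p + along X (f b) p *\<^sub>R V b)"
  using assms
proof (induction S rule: finite_induct)
  case empty
  show ?case
    using affine_connection_scaleR_right[of "\<lambda>_. 0" X "\<lambda>_. 0" p] empty U
    by (simp add: smooth_on_const along_def frechet_derivative_const)
next
  case (insert b S)
  then show ?case
    using affine_connection_add_right[of X "\<lambda>q. f b q *\<^sub>R V b" "\<lambda>q. \<Sum>b\<in>S. f b q *\<^sub>R V b" p] U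
    by (simp add: affine_connection_scaleR_right smooth_on_intros)
qed

text \<open>The Christoffel symbols at \<open>p\<close>, collected into one bilinear map.
  Homogeneity in the second argument holds because the Leibniz term of a constant factor
  vanishes.\<close>

lemma bilinear_affine_connection_const:
  assumes "p \<in> U"
  shows "bilinear (\<lambda>u v. nab (\<lambda>_. u) (\<lambda>_. v) p)"
proof -
  have 0: "along X (\<lambda>_. c) p = 0" for X c
    by (simp add: along_def frechet_derivative_const)
  note [simp] = smooth_on_const[OF U] assms
  have "nab (\<lambda>_. u + u') (\<lambda>_. v) p = nab (\<lambda>_. u) (\<lambda>_. v) p + nab (\<lambda>_. u') (\<lambda>_. v) p" for u u' v
    by (rule affine_connection_add_left) simp_all
  moreover have "nab (\<lambda>_. u) (\<lambda>_. v + v') p = nab (\<lambda>_. u) (\<lambda>_. v) p + nab (\<lambda>_. u) (\<lambda>_. v') p" for u v v'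
    by (rule affine_connection_add_right) simp_all
  moreover have "nab (\<lambda>_. c *\<^sub>R u) (\<lambda>_. v) p = c *\<^sub>R nab (\<lambda>_. u) (\<lambda>_. v) p" for c u v
    by (rule affine_connection_scaleR_left[of "\<lambda>_. c"]) simp_all
  moreover have "nab (\<lambda>_. u) (\<lambda>_. c *\<^sub>R v) p = c *\<^sub>R nab (\<lambda>_. u) (\<lambda>_. v) p" for c u v
    using affine_connection_scaleR_right[of "\<lambda>_. c" "\<lambda>_. u" "\<lambda>_. v" p] by (simp add: 0)
  ultimately show ?thesis
    by (simp add: bilinear_def linear_iff)
qed

text \<open>Expanding both fields in the standard basis, the Leibniz rule produces the flat
  derivative of \<open>Y\<close> along \<open>X\<close>, and what remains depends only on the values
  \<open>X p\<close> and \<open>Y p\<close>.\<close>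

lemma affine_connection_flat_coordinates:
  assumes X: "smooth_on U X" and Y: "smooth_on U Y" and p: "p \<in> U"
  shows "nab X Y p = frechet_derivative Y (at p) (X p) + nab (\<lambda>_. X p) (\<lambda>_. Y p) p"
proof -
  have "nab X Y p = nab (\<lambda>q. \<Sum>b\<in>Basis. (X q \<bullet> b) *\<^sub>R b) Y p"
    by (simp add: euclidean_representation)
  also have "\<dots> = (\<Sum>b\<in>Basis. (X p \<bullet> b) *\<^sub>R nab (\<lambda>_. b) Y p)"
    using X Y p U by (intro affine_connection_sum_left) (auto intro: smooth_on_inner)
  \<comment> \<open>The same rule, read backwards with constant coefficients, replaces
    \<open>X\<close> by the constant field with value \<open>X p\<close>.\<close>
  also have "\<dots> = nab (\<lambda>_. \<Sum>b\<in>Basis. (X p \<bullet> b) *\<^sub>R b) Y p"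
    using Y p U by (intro affine_connection_sum_left[symmetric]) (auto intro: smooth_on_const)
  also have "\<dots> = nab (\<lambda>_. X p) Y p"
    by (simp add: euclidean_representation)
  also have "\<dots> = nab (\<lambda>_. X p) (\<lambda>q. \<Sum>b\<in>Basis. (Y q \<bullet> b) *\<^sub>R b) p"
    by (simp add: euclidean_representation)
  also have "\<dots> = (\<Sum>b\<in>Basis. (Y p \<bullet> b) *\<^sub>R nab (\<lambda>_. X p) (\<lambda>_. b) p +
      along (\<lambda>_. X p) (\<lambda>q. Y q \<bullet> b) p *\<^sub>R b)"
    using Y p U by (intro affine_connection_sum_right) (auto intro: smooth_on_inner smooth_on_const)
  also have "\<dots> = (\<Sum>b\<in>Basis. (Y p \<bullet> b) *\<^sub>R nab (\<lambda>_. X p) (\<lambda>_. b) p) +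
      (\<Sum>b\<in>Basis. (frechet_derivative Y (at p) (X p) \<bullet> b) *\<^sub>R b)"
  proof -
    have "frechet_derivative (\<lambda>q. Y q \<bullet> b) (at p) = (\<lambda>v. frechet_derivative Y (at p) v \<bullet> b)" for b
      using has_derivative_inner_left[OF smooth_on_has_derivative[OF Y p]] frechet_derivative_at by metis
    then show ?thesis by (simp add: along_def sum.distrib)
  qed
  also have "(\<Sum>b\<in>Basis. (Y p \<bullet> b) *\<^sub>R nab (\<lambda>_. X p) (\<lambda>_. b) p) = nab (\<lambda>_. X p) (\<lambda>_. Y p) p"
  proof -
    have L: "linear (\<lambda>v. nab (\<lambda>_. X p) (\<lambda>_. v) p)"
      using bilinear_affine_connection_const[OF p] by (simp add: bilinear_def)
    show ?thesis
      using linear_sum[OF L, of "\<lambda>b. (Y p \<bullet> b) *\<^sub>R b" Basis]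
      by (simp add: linear_cmul[OF L] euclidean_representation)
  qed
  finally show ?thesis by (simp add: euclidean_representation)
qed

end

subsection \<open>Fisher metric and cubic form of the normal family\<close>

lemma mem_normal_family: "p \<in> normal_family \<longleftrightarrow> snd p > 0"
  by (auto simp: normal_family_def)

lemma open_normal_family: "open normal_family"
proof -
  have "normal_family = UNIV \<times> {0<..}" unfolding normal_family_def by auto
  then show ?thesis by (metis open_Times open_UNIV open_greaterThan)
qed

text \<open>In the standardized variable \<open>z = (t - \<mu>) / \<sigma>\<close> the scores are
  multiples of the Hermite polynomials \<open>z\<close> and \<open>z\<^sup>2 - 1\<close>, which
  turns the Fisher integrals into moments of the standard normal law.\<close>

lemma score_eq:
  assumes "snd \<theta> > 0"
  shows "score \<theta> u t = (fst u * ((t - fst \<theta>) / snd \<theta>) + snd u * (((t - fst \<theta>) / snd \<theta>)\<^sup>2 - 1)) / snd \<theta>"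
proof -
  \<comment> \<open>This form of the log-density is valid only for positive \<open>\<sigma>\<close>;
    agreement on that open set suffices for the derivative.\<close>
  let ?f = "\<lambda>\<eta>::real \<times> real. - ln (sqrt (2 * pi)) - ln (snd \<eta>) - (t - fst \<eta>)\<^sup>2 / (2 * (snd \<eta>)\<^sup>2)"
  have f: "ln (normal_density (fst \<eta>) (snd \<eta>) t) = ?f \<eta>" if "\<eta> \<in> normal_family" for \<eta>
  proof -
    have "snd \<eta> > 0" using that by (simp add: mem_normal_family)
    then have "normal_density (fst \<eta>) (snd \<eta>) t =
        exp (- (t - fst \<eta>)\<^sup>2 / (2 * (snd \<eta>)\<^sup>2)) / (sqrt (2 * pi) * snd \<eta>)"
      by (simp add: normal_density_def real_sqrt_mult)
    also have "ln \<dots> = ?f \<eta>"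
      using \<open>snd \<eta> > 0\<close> by (subst ln_divide_pos) (auto simp: ln_mult_pos)
    finally show ?thesis .
  qed
  have "frechet_derivative (\<lambda>\<eta>. ln (normal_density (fst \<eta>) (snd \<eta>) t)) (at \<theta>) = frechet_derivative ?f (at \<theta>)"
    by (rule frechet_derivative_cong_open[OF open_normal_family _ f]) (use assms in \<open>simp_all only: mem_normal_family\<close>)
  then have score: "score \<theta> u t = frechet_derivative ?f (at \<theta>) u"
    by (simp only: score_def)
  have "(?f has_derivative (\<lambda>u. (fst u * ((t - fst \<theta>) / snd \<theta>)
      + snd u * (((t - fst \<theta>) / snd \<theta>)\<^sup>2 - 1)) / snd \<theta>)) (at \<theta>)"
  proof -
    let ?m = "t - fst \<theta>" and ?s = "snd \<theta>"
    have "(?f has_derivative (\<lambda>u. 0 - snd u * inverse ?s -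
        (2 * (0 - fst u) * ?m * (2 * ?s\<^sup>2) - ?m\<^sup>2 * (2 * (2 * snd u * ?s))) / (2 * ?s\<^sup>2 * (2 * ?s\<^sup>2)))) (at \<theta>)"
      using assms by (auto intro!: derivative_eq_intros simp: fun_eq_iff)
    moreover have "0 - snd u * inverse ?s - (2 * (0 - fst u) * ?m * (2 * ?s\<^sup>2) - ?m\<^sup>2 * (2 * (2 * snd u * ?s)))
        / (2 * ?s\<^sup>2 * (2 * ?s\<^sup>2)) = (fst u * (?m / ?s) + snd u * ((?m / ?s)\<^sup>2 - 1)) / ?s" for u
    proof -
      define m s where "m = ?m" and "s = ?s"
      have "s \<noteq> 0" using assms by (simp add: s_def)
      then show ?thesis
        unfolding m_def[symmetric] s_def[symmetric] by (simp add: field_simps power2_eq_square)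
    qed
    ultimately show ?thesis by (simp only:)
  qed
  from frechet_derivative_at[OF this] show ?thesis
    unfolding score by (rule fun_cong[symmetric])
qed

lemma has_bochner_integral_standardized_moment:
  assumes "\<sigma> > 0" "has_bochner_integral lborel (\<lambda>t. normal_density \<mu> \<sigma> t * (t - \<mu>) ^ k) (m * \<sigma> ^ k)"
  shows "has_bochner_integral lborel (\<lambda>t. ((t - \<mu>) / \<sigma>) ^ k * normal_density \<mu> \<sigma> t) m"
  using has_bochner_integral_mult_right[of "1 / \<sigma> ^ k", OF assms(2)] assms(1)
  by (simp add: power_divide mult.commute)

text \<open>Degree six is what a product of three quadratic scores requires. The odd moments vanish,
  and the even ones up to order six are 1, 1, 3, 15.\<close>

lemma normal_expectation_standardized_poly:
  fixes \<theta> :: "real \<times> real"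
  assumes "snd \<theta> > 0"
  defines "z \<equiv> \<lambda>t. (t - fst \<theta>) / snd \<theta>"
  assumes f: "\<And>t. f t = (c0 + c1 * z t + c2 * z t ^ 2 + c3 * z t ^ 3 + c4 * z t ^ 4 + c5 * z t ^ 5
    + c6 * z t ^ 6) / d"
  shows "normal_expectation \<theta> f = (c0 + c2 + 3 * c4 + 15 * c6) / d"
proof -
  obtain \<mu> \<sigma> where \<theta>: "\<theta> = (\<mu>, \<sigma>)" by (cases \<theta>)
  then have \<sigma>: "\<sigma> > 0" using assms by simp
  let ?I = "\<lambda>k m. has_bochner_integral lborel (\<lambda>t. z t ^ k * normal_density \<mu> \<sigma> t) m"
  have I: "?I k m" if "has_bochner_integral lborel (\<lambda>t. normal_density \<mu> \<sigma> t * (t - \<mu>) ^ k) (m * \<sigma> ^ k)" for k m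
    using has_bochner_integral_standardized_moment[OF \<sigma> that] by (simp add: z_def \<theta>)
  have odd: "?I (2 * k + 1) 0" for k
    using I[of "2 * k + 1" 0] normal_moment_odd[OF \<sigma>, of \<mu> k] by simp
  have even: "?I (2 * k) (fact (2 * k) / (2 ^ k * fact k))" for k
  proof (rule I)
    have "fact (2 * k) / ((2 / \<sigma>\<^sup>2) ^ k * fact k) = fact (2 * k) / (2 ^ k * fact k) * \<sigma> ^ (2 * k)"
      using \<sigma> by (simp add: power_divide field_simps flip: power_mult)
    then show "has_bochner_integral lborel (\<lambda>t. normal_density \<mu> \<sigma> t * (t - \<mu>) ^ (2 * k))
        (fact (2 * k) / (2 ^ k * fact k) * \<sigma> ^ (2 * k))"
      using normal_moment_even[OF \<sigma>, of \<mu> k] by simp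
  qed
  \<comment> \<open>The values of \<open>(2k)! / (2^k k!)\<close> for
    \<open>k = 0, 1, 2, 3\<close>.\<close>
  have I0: "?I 0 1" and I2: "?I 2 1" and I4: "?I 4 3" and I6: "?I 6 15"
    using even[of 0] even[of 1] even[of 2] even[of 3] by (simp_all add: fact_numeral)
  have I1: "?I 1 0" and I3: "?I 3 0" and I5: "?I 5 0"
    using odd[of 0] odd[of 1] odd[of 2] by (simp_all add: numeral_eq_Suc)
  have "has_bochner_integral lborel (\<lambda>t. c0 * (z t ^ 0 * normal_density \<mu> \<sigma> t)
      + c1 * (z t ^ 1 * normal_density \<mu> \<sigma> t) + c2 * (z t ^ 2 * normal_density \<mu> \<sigma> t)
      + c3 * (z t ^ 3 * normal_density \<mu> \<sigma> t) + c4 * (z t ^ 4 * normal_density \<mu> \<sigma> t)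
      + c5 * (z t ^ 5 * normal_density \<mu> \<sigma> t) + c6 * (z t ^ 6 * normal_density \<mu> \<sigma> t))
      (c0 * 1 + c1 * 0 + c2 * 1 + c3 * 0 + c4 * 3 + c5 * 0 + c6 * 15)"
    by (intro has_bochner_integral_add has_bochner_integral_mult_right I0 I1 I2 I3 I4 I5 I6)
  from has_bochner_integral_divide_zero[OF this, of d]
  have "has_bochner_integral lborel (\<lambda>t. f t * normal_density \<mu> \<sigma> t)
      ((c0 * 1 + c1 * 0 + c2 * 1 + c3 * 0 + c4 * 3 + c5 * 0 + c6 * 15) / d)"
    by (rule has_bochner_integral_cong[THEN iffD1, rotated -1])
      (simp_all only: f times_divide_eq_left distrib_right mult.assoc power_0 power_one_right mult_1)
  from has_bochner_integral_integral_eq[OF this] show ?thesis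
    by (simp add: normal_expectation_def \<theta> mult.commute)
qed

text \<open>The product of two scores is a polynomial of degree four in \<open>z\<close>, padded
  with zero coefficients to fit the moment formula.\<close>

lemma fisher_metric_eq:
  assumes "snd p > 0"
  shows "fisher_metric p u v = (fst u * fst v + 2 * (snd u * snd v)) / (snd p)\<^sup>2"
proof -
  let ?s = "fst u * snd v + snd u * fst v" and ?d = "snd u * snd v"
  have "score p u t * score p v t = (?d + (- ?s) * z + (fst u * fst v - 2 * ?d) * z ^ 2 + ?s * z ^ 3
      + ?d * z ^ 4 + 0 * z ^ 5 + 0 * z ^ 6) / (snd p)\<^sup>2"
    if "z = (t - fst p) / snd p" for t z
  proof -
    have "(fst u * z + snd u * (z\<^sup>2 - 1)) * (fst v * z + snd v * (z\<^sup>2 - 1)) = ?d + (- ?s) * z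
        + (fst u * fst v - 2 * ?d) * z ^ 2 + ?s * z ^ 3 + ?d * z ^ 4 + 0 * z ^ 5 + 0 * z ^ 6"
      by algebra
    then show ?thesis
      unfolding score_eq[OF assms] that[symmetric] by (simp add: power2_eq_square[of "snd p"])
  qed
  then have "fisher_metric p u v = (?d + (fst u * fst v - 2 * ?d) + 3 * ?d + 15 * 0) / (snd p)\<^sup>2"
    unfolding fisher_metric_def by (intro normal_expectation_standardized_poly[OF assms]) blast
  also have "?d + (fst u * fst v - 2 * ?d) + 3 * ?d + 15 * 0 = fst u * fst v + 2 * ?d"
    by algebra
  finally show ?thesis .
qed

lemma fisher_cubic_eq:
  assumes "snd p > 0"
  shows "fisher_cubic p u v w = (2 * (fst u * fst v * snd w + fst u * snd v * fst w + snd u * fst v * fst w)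
    + 8 * (snd u * snd v * snd w)) / (snd p) ^ 3"
proof -
  let ?s0 = "fst u * fst v * fst w"
  let ?s1 = "fst u * snd v * snd w + snd u * fst v * snd w + snd u * snd v * fst w"
  let ?s2 = "fst u * fst v * snd w + fst u * snd v * fst w + snd u * fst v * fst w"
  let ?s3 = "snd u * snd v * snd w"
  have "score p u t * score p v t * score p w t = (- ?s3 + ?s1 * z + (3 * ?s3 - ?s2) * z ^ 2
      + (?s0 - 2 * ?s1) * z ^ 3 + (?s2 - 3 * ?s3) * z ^ 4 + ?s1 * z ^ 5 + ?s3 * z ^ 6) / (snd p) ^ 3"
    if "z = (t - fst p) / snd p" for t z
  proof -
    have "(fst u * z + snd u * (z\<^sup>2 - 1)) * (fst v * z + snd v * (z\<^sup>2 - 1))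
        * (fst w * z + snd w * (z\<^sup>2 - 1)) = - ?s3 + ?s1 * z + (3 * ?s3 - ?s2) * z ^ 2
        + (?s0 - 2 * ?s1) * z ^ 3 + (?s2 - 3 * ?s3) * z ^ 4 + ?s1 * z ^ 5 + ?s3 * z ^ 6"
      by algebra
    then show ?thesis
      unfolding score_eq[OF assms] that[symmetric] by (simp add: power3_eq_cube[of "snd p"])
  qed
  then have "fisher_cubic p u v w = (- ?s3 + (3 * ?s3 - ?s2) + 3 * (?s2 - 3 * ?s3) + 15 * ?s3) / (snd p) ^ 3"
    unfolding fisher_cubic_def by (intro normal_expectation_standardized_poly[OF assms]) blast
  also have "- ?s3 + (3 * ?s3 - ?s2) + 3 * (?s2 - 3 * ?s3) + 15 * ?s3 = 2 * ?s2 + 8 * ?s3"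
    by algebra
  finally show ?thesis .
qed

subsection \<open>The affine group\<close>

text \<open>The product of \<open>p\<close> and \<open>q\<close> is the law of
  \<open>fst p + snd p * T\<close> for \<open>T\<close> distributed according to \<open>q\<close>:
  the affine maps of the line, acting on normal distributions.\<close>

definition affine_group :: "(real \<times> real) monoid" where
  "affine_group = \<lparr>carrier = normal_family,
    mult = (\<lambda>p q. (fst p + snd p * fst q, snd p * snd q)), one = (0, 1)\<rparr>"

lemma affine_group_simps [simp]:
  "carrier affine_group = normal_family"
  "p \<otimes>\<^bsub>affine_group\<^esub> q = (fst p + snd p * fst q, snd p * snd q)"
  "\<one>\<^bsub>affine_group\<^esub> = (0, 1)"
  by (simp_all add: affine_group_def)

lemma group_affine_group: "group affine_group"
proof (rule groupI)
  fix p assume "p \<in> carrier affine_group"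
  \<comment> \<open>The witness is the inverse of the affine map that sends \<open>t\<close> to
    \<open>fst p + snd p * t\<close>.\<close>
  then show "\<exists>q\<in>carrier affine_group. q \<otimes>\<^bsub>affine_group\<^esub> p = \<one>\<^bsub>affine_group\<^esub>"
    by (intro bexI[of _ "(- fst p / snd p, 1 / snd p)"]) (auto simp: mem_normal_family)
qed (auto simp: mem_normal_family algebra_simps)

lemma inv_affine_group:
  assumes "p \<in> normal_family"
  shows "inv\<^bsub>affine_group\<^esub> p = (- fst p / snd p, 1 / snd p)"
  using assms by (intro group.inv_equality[OF group_affine_group]) (auto simp: mem_normal_family)

lemma lie_group_affine_group: "lie_group affine_group"
  unfolding lie_group_def
proof (intro conjI)
  have "open (normal_family \<times> normal_family)"
    by (intro open_Times open_normal_family)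
  then show "smooth_on (carrier affine_group \<times> carrier affine_group) (\<lambda>(a, b). a \<otimes>\<^bsub>affine_group\<^esub> b)"
    unfolding case_prod_beta affine_group_simps by (intro smooth_on_intros)
  have "smooth_on normal_family (\<lambda>p::real \<times> real. (- fst p / snd p, 1 / snd p))"
    by (intro smooth_on_intros open_normal_family) (auto simp: mem_normal_family)
  then show "smooth_on (carrier affine_group) (\<lambda>a. inv\<^bsub>affine_group\<^esub> a)"
    unfolding affine_group_simps by (subst smooth_on_cong[OF open_normal_family inv_affine_group])
qed (simp_all add: group_affine_group open_normal_family)

lemma left_diff_affine_group: "left_diff affine_group a p u = snd a *\<^sub>R u"
proof -
  have "((\<lambda>x. a \<otimes>\<^bsub>affine_group\<^esub> x) has_derivative (\<lambda>u. (snd a * fst u, snd a * snd u))) (at p)"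
    unfolding affine_group_simps by (auto intro!: derivative_eq_intros)
  from frechet_derivative_at[OF this] show ?thesis
    by (auto simp: left_diff_def scaleR_prod_def dest: fun_cong[where x=u])
qed

text \<open>Left translation by \<open>a\<close> scales both vectors and the height
  \<open>snd p\<close> by \<open>snd a\<close>, so numerator and denominator pick up the same
  square.\<close>

lemma left_invariant_fisher_metric: "left_invariant_metric affine_group fisher_metric"
proof -
  have "fisher_metric (a \<otimes>\<^bsub>affine_group\<^esub> p) (snd a *\<^sub>R u) (snd a *\<^sub>R v) = fisher_metric p u v"
    if "snd a > 0" "snd p > 0" for a p u v
    using that by (simp add: fisher_metric_eq field_simps power2_eq_square)
  then show ?thesis
    by (auto simp: left_invariant_metric_def left_diff_affine_group mem_normal_family)
qed

subsection \<open>Left-invariant connections on the half plane\<close>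

text \<open>\<open>\<gamma>\<close> is the Christoffel map at the identity \<open>(0, 1)\<close>;
  the factor \<open>1 / snd p\<close> is what left-invariance dictates elsewhere. Only smooth fields
  and points of the half plane are compared, since a connection is unconstrained beyond
  them.\<close>

definition has_christoffel :: "(real \<times> real \<Rightarrow> real \<times> real \<Rightarrow> real \<times> real) \<Rightarrow> (real \<times> real) connection \<Rightarrow> bool"
  where
  "has_christoffel \<gamma> nab \<longleftrightarrow> bounded_bilinear \<gamma> \<and>
    (\<forall>X\<in>vector_fields normal_family. \<forall>Y\<in>vector_fields normal_family. \<forall>p\<in>normal_family.
      nab X Y p = frechet_derivative Y (at p) (X p) + (1 / snd p) *\<^sub>R \<gamma> (X p) (Y p))"

lemma has_christoffelD:
  "has_christoffel \<gamma> nab \<Longrightarrow> smooth_on normal_family X \<Longrightarrow> smooth_on normal_family Y \<Longrightarrow> snd p > 0 \<Longrightarrow>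
    nab X Y p = frechet_derivative Y (at p) (X p) + (1 / snd p) *\<^sub>R \<gamma> (X p) (Y p)"
  by (simp add: has_christoffel_def vector_fields_iff mem_normal_family)

text \<open>Translation by \<open>p\<close> carries the identity to \<open>p\<close> and multiplies
  constant fields by \<open>snd p\<close>. Invariance thus equates \<open>(snd p)\<^sup>2\<close>
  times the Christoffel map at \<open>p\<close> with \<open>snd p\<close> times the one at the
  identity.\<close>

lemma left_invariant_has_christoffel:
  assumes nab: "affine_connection normal_family nab" "left_invariant_connection affine_group nab"
  shows "has_christoffel (\<lambda>u v. nab (\<lambda>_. u) (\<lambda>_. v) (0, 1)) nab"
proof -
  note N = open_normal_family
  have one: "(0, 1) \<in> normal_family" by (simp add: mem_normal_family)
  have "nab (\<lambda>_. u) (\<lambda>_. v) p = (1 / snd p) *\<^sub>R nab (\<lambda>_. u) (\<lambda>_. v) (0, 1)"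
    if p: "p \<in> normal_family" for u v p
  proof -
    let ?b = "snd p"
    have b: "?b > 0" using p by (simp add: mem_normal_family)
    have inv: "inv\<^bsub>affine_group\<^esub> p \<otimes>\<^bsub>affine_group\<^esub> p = (0, 1)"
      using group.l_inv[OF group_affine_group, of p] p by simp
    have push: "left_push affine_group p (\<lambda>_. u) = (\<lambda>_. ?b *\<^sub>R u)" for u
      by (simp add: left_push_def left_diff_affine_group fun_eq_iff)
    note bil = bilinear_affine_connection_const[OF N nab(1) p]
    have "(?b * ?b) *\<^sub>R nab (\<lambda>_. u) (\<lambda>_. v) p = nab (\<lambda>_. ?b *\<^sub>R u) (\<lambda>_. ?b *\<^sub>R v) p"
      using bilinear_lmul[OF bil, of ?b u "?b *\<^sub>R v"] bilinear_rmul[OF bil, of u ?b v] by simp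
    also have "\<dots> = left_push affine_group p (nab (\<lambda>_. u) (\<lambda>_. v)) p"
      using nab(2) p unfolding left_invariant_connection_def push[symmetric]
      by (auto simp: vector_fields_iff smooth_on_const N)
    also have "\<dots> = ?b *\<^sub>R nab (\<lambda>_. u) (\<lambda>_. v) (0, 1)"
      by (simp only: left_push_def left_diff_affine_group inv)
    finally have "(1 / (?b * ?b)) *\<^sub>R (?b * ?b) *\<^sub>R nab (\<lambda>_. u) (\<lambda>_. v) p =
        (1 / (?b * ?b)) *\<^sub>R ?b *\<^sub>R nab (\<lambda>_. u) (\<lambda>_. v) (0, 1)"
      by simp
    with b show ?thesis by simp
  qed
  moreover have "bounded_bilinear (\<lambda>u v. nab (\<lambda>_. u) (\<lambda>_. v) (0, 1))"
    using bilinear_affine_connection_const[OF N nab(1) one] by (simp add: bilinear_conv_bounded_bilinear)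
  ultimately show ?thesis
    using affine_connection_flat_coordinates[OF N nab(1)] by (simp add: has_christoffel_def vector_fields_iff)
qed

section \<open>Fisher metric and cubic form in the left-invariant frame\<close>

text \<open>The Fisher metric at the identity, that is, its components in the left-invariant
  frame.\<close>

definition frame_metric :: "real \<times> real \<Rightarrow> real \<times> real \<Rightarrow> real" where
  "frame_metric u v = fst u * fst v + 2 * (snd u * snd v)"

lemma bounded_bilinear_frame_metric: "bounded_bilinear frame_metric"
  unfolding bilinear_conv_bounded_bilinear[symmetric] bilinear_def linear_iff frame_metric_def
  by (simp add: algebra_simps)

lemma frame_metric_eq_iff: "(\<forall>v. frame_metric u v = frame_metric w v) \<longleftrightarrow> u = w"
proof
  assume "\<forall>v. frame_metric u v = frame_metric w v"
  from this[rule_format, of "(1, 0)"] this[rule_format, of "(0, 1)"] show "u = w"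
    by (simp add: frame_metric_def prod_eq_iff)
qed simp

lemma fisher_metric_frame: "snd p > 0 \<Longrightarrow> fisher_metric p u v = frame_metric u v / (snd p)\<^sup>2"
  by (simp add: fisher_metric_eq frame_metric_def)

text \<open>The difference tensor \<open>K\<close> whose cubic form has the components \<open>a = C\<^sub>1\<^sub>1\<^sub>1\<close>, \<open>b = C\<^sub>1\<^sub>1\<^sub>2\<close>,
  \<open>c = C\<^sub>1\<^sub>2\<^sub>2\<close>, \<open>d = C\<^sub>2\<^sub>2\<^sub>2\<close> in the left-invariant frame \<open>y\<partial>\<^sub>x\<close>, \<open>y\<partial>\<^sub>y\<close>.\<close>

definition skew :: "real \<Rightarrow> real \<Rightarrow> real \<Rightarrow> real \<Rightarrow> real \<times> real \<Rightarrow> real \<times> real \<Rightarrow> real \<times> real" where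
  "skew a b c d u v =
    (a * (fst u * fst v) + b * (fst u * snd v + snd u * fst v) + c * (snd u * snd v),
     (b * (fst u * fst v) + c * (fst u * snd v + snd u * fst v) + d * (snd u * snd v)) / 2)"

text \<open>The first pair holds the Levi-Civita symbols times the height; the subtracted term
  realizes \<open>\<nabla> = \<nabla>\<^sup>g - K / 2\<close>.\<close>

definition christoffel :: "real \<Rightarrow> real \<Rightarrow> real \<Rightarrow> real \<Rightarrow> real \<times> real \<Rightarrow> real \<times> real \<Rightarrow> real \<times> real" where
  "christoffel a b c d u v =
    (- (fst u * snd v + snd u * fst v), fst u * fst v / 2 - snd u * snd v) - (1 / 2) *\<^sub>R skew a b c d u v"

lemma bounded_bilinear_skew: "bounded_bilinear (skew a b c d)"
  unfolding bilinear_conv_bounded_bilinear[symmetric] bilinear_def linear_iff skew_def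
  by (simp add: field_simps)

lemma bounded_bilinear_christoffel: "bounded_bilinear (christoffel a b c d)"
  unfolding bilinear_conv_bounded_bilinear[symmetric] bilinear_def linear_iff christoffel_def skew_def
  by (simp add: field_simps)

text \<open>Quotient rule for the height weights of invariant tensors, used for the metric (weight
  2) and the cubic form (weight 3). Writing the exponent as \<open>Suc k\<close> keeps the power
  rule free of truncated subtraction.\<close>

lemma along_divide_power:
  fixes f :: "real \<times> real \<Rightarrow> real"
  assumes "(f has_derivative D) (at p)" "snd p \<noteq> 0"
  shows "along X (\<lambda>q. f q / snd q ^ Suc k) p = D (X p) / snd p ^ Suc k - real (Suc k) * snd (X p) * f p / snd p ^ Suc (Suc k)"
proof -
  have "((\<lambda>q::real \<times> real. snd q ^ Suc k) has_derivative (\<lambda>u. real (Suc k) * snd u * snd p ^ k)) (at p)"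
    using has_derivative_power[OF has_derivative_snd[OF has_derivative_ident], of "Suc k" p UNIV]
    by (simp only: diff_Suc_1)
  from has_derivative_divide'[OF assms(1) this]
  have "frechet_derivative (\<lambda>q. f q / snd q ^ Suc k) (at p) =
      (\<lambda>u. (D u * snd p ^ Suc k - f p * (real (Suc k) * snd u * snd p ^ k)) / (snd p ^ Suc k * snd p ^ Suc k))"
    using assms(2) by (intro frechet_derivative_at[symmetric]) simp
  then show ?thesis
    using assms(2) by (simp add: along_def field_simps)
qed

lemma along_metric_app_fisher:
  assumes "smooth_on normal_family Y" "smooth_on normal_family Z" "snd p > 0"
  shows "along X (metric_app fisher_metric Y Z) p =
    (frame_metric (Y p) (frechet_derivative Z (at p) (X p)) + frame_metric (frechet_derivative Y (at p) (X p)) (Z p)) / (snd p)\<^sup>2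
    - 2 * snd (X p) * frame_metric (Y p) (Z p) / (snd p) ^ 3"
proof -
  have p: "p \<in> normal_family" using assms by (simp add: mem_normal_family)
  have "along X (metric_app fisher_metric Y Z) p = along X (\<lambda>q. frame_metric (Y q) (Z q) / snd q ^ Suc 1) p"
    unfolding along_def
    by (subst frechet_derivative_cong_open[OF open_normal_family p])
      (auto simp: metric_app_def fisher_metric_frame mem_normal_family power2_eq_square)
  also have "\<dots> = (frame_metric (Y p) (frechet_derivative Z (at p) (X p)) + frame_metric (frechet_derivative Y (at p) (X p)) (Z p)) / snd p ^ Suc 1
    - real (Suc 1) * snd (X p) * frame_metric (Y p) (Z p) / snd p ^ Suc (Suc 1)"
    by (rule along_divide_power[where D="\<lambda>u. frame_metric (Y p) (frechet_derivative Z (at p) u)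
        + frame_metric (frechet_derivative Y (at p) u) (Z p)"])
      (use assms smooth_on_has_derivative p in \<open>auto intro!: bounded_bilinear.FDERIV[OF bounded_bilinear_frame_metric]\<close>)
  finally show ?thesis by (simp add: eval_nat_numeral)
qed

text \<open>The cubic form at the identity of a connection with symbols \<open>\<gamma>\<close>. The
  first term is the derivative of the weight in
  \<open>frame_metric / (snd p)\<^sup>2\<close>.\<close>

definition frame_cubic ::
  "(real \<times> real \<Rightarrow> real \<times> real \<Rightarrow> real \<times> real) \<Rightarrow> real \<times> real \<Rightarrow> real \<times> real \<Rightarrow> real \<times> real \<Rightarrow> real" where
  "frame_cubic \<gamma> u v w =
    - 2 * snd u * frame_metric v w - frame_metric (\<gamma> u v) w - frame_metric v (\<gamma> u w)"

text \<open>The derivatives of \<open>Y\<close> and \<open>Z\<close> cancel. The connection is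
  prescribed only at the single point \<open>p\<close>, so that the formula also applies to a
  Levi-Civita connection whose left-invariance is not yet established.\<close>

lemma cubic_form_at:
  assumes YZ: "smooth_on normal_family Y" "smooth_on normal_family Z" and p: "snd p > 0"
    and Y: "nab X Y p = frechet_derivative Y (at p) (X p) + (1 / snd p) *\<^sub>R \<gamma> (X p) (Y p)"
    and Z: "nab X Z p = frechet_derivative Z (at p) (X p) + (1 / snd p) *\<^sub>R \<gamma> (X p) (Z p)"
  shows "cubic_form fisher_metric nab X Y Z p = frame_cubic \<gamma> (X p) (Y p) (Z p) / snd p ^ 3"
proof -
  interpret frame: bounded_bilinear frame_metric by (rule bounded_bilinear_frame_metric)
  show ?thesis
    unfolding cubic_form_def along_metric_app_fisher[OF YZ p] metric_app_def Y Z fisher_metric_frame[OF p]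
      frame_cubic_def frame.add_left frame.add_right frame.scaleR_left frame.scaleR_right
    using p by (simp add: field_simps power2_eq_square power3_eq_cube)
qed

text \<open>The Levi-Civita part is metric and contributes nothing; the two halves of
  \<open>K\<close> add up because \<open>K\<close> is self-adjoint.\<close>

lemma frame_cubic_christoffel: "frame_cubic (christoffel a b c d) u v w = frame_metric (skew a b c d u v) w"
  unfolding frame_cubic_def frame_metric_def christoffel_def skew_def by (simp add: field_simps)

text \<open>The six components of a symmetric \<open>\<gamma>\<close> are subject to two conditions, hence the four parameters.\<close>

lemma symmetric_frame_cubic_imp_christoffel:
  assumes "bounded_bilinear \<gamma>" "\<And>u v. \<gamma> u v = \<gamma> v u"
    and "\<And>u v w. frame_cubic \<gamma> u v w = frame_cubic \<gamma> v u w"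
  obtains a b c d where "\<gamma> = christoffel a b c d"
proof -
  interpret \<gamma>: bounded_bilinear \<gamma> by fact
  obtain p1 p2 q1 q2 r1 r2 where g: "\<gamma> (1, 0) (1, 0) = (p1, p2)" "\<gamma> (1, 0) (0, 1) = (q1, q2)"
    "\<gamma> (0, 1) (0, 1) = (r1, r2)"
    by (metis prod.exhaust)
  have g': "\<gamma> (0, 1) (1, 0) = (q1, q2)" using assms(2) g by metis
  have e: "u = fst u *\<^sub>R (1, 0) + snd u *\<^sub>R (0, 1)" for u :: "real \<times> real"
    by (simp add: prod_eq_iff)
  have \<gamma>: "\<gamma> u v = (fst u * fst v) *\<^sub>R (p1, p2) + (fst u * snd v + snd u * fst v) *\<^sub>R (q1, q2) + (snd u * snd v) *\<^sub>R (r1, r2)" for u v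
    by (subst e[of u], subst e[of v])
      (simp only: \<gamma>.add_left \<gamma>.add_right \<gamma>.scaleR_left \<gamma>.scaleR_right g g', simp add: prod_eq_iff algebra_simps)
  \<comment> \<open>Exchanging the first two arguments of the cubic form, for the two independent
    choices of the third basis vector, gives these relations.\<close>
  have q: "q1 = 2 * p2 - 2" "r1 = 2 * q2"
    using assms(3)[of "(1, 0)" "(0, 1)" "(1, 0)"] assms(3)[of "(1, 0)" "(0, 1)" "(0, 1)"]
    by (simp_all add: frame_cubic_def frame_metric_def g g')
  \<comment> \<open>The parameters come from solving for the components:
    \<open>p1 = - a / 2\<close>, \<open>q1 = - 1 - b / 2\<close>, \<open>q2 = - c / 4\<close>,
    \<open>r2 = - 1 - d / 4\<close>.\<close>
  have "\<gamma> u v = christoffel (- 2 * p1) (- 2 - 2 * q1) (- 4 * q2) (- 4 - 4 * r2) u v" for u v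
    unfolding \<gamma> christoffel_def skew_def q by (simp add: prod_eq_iff field_simps)
  then show ?thesis by (intro that ext)
qed

text \<open>Uniqueness of the Levi-Civita symbols: a vanishing cubic form is symmetric, so the
  four-parameter family applies, and its parameters are the components of the cubic form.\<close>

lemma frame_cubic_zero_imp_christoffel:
  assumes "bounded_bilinear \<gamma>" "\<And>u v. \<gamma> u v = \<gamma> v u" "\<And>u v w. frame_cubic \<gamma> u v w = 0"
  shows "\<gamma> = christoffel 0 0 0 0"
proof -
  obtain a b c d where \<gamma>: "\<gamma> = christoffel a b c d"
    by (rule symmetric_frame_cubic_imp_christoffel[OF assms(1,2)]) (simp_all only: assms(3))
  then have C: "frame_metric (skew a b c d u v) w = 0" for u v w
    using assms(3) by (simp add: frame_cubic_christoffel)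
  show ?thesis
    using C[of "(1, 0)" "(1, 0)" "(1, 0)"] C[of "(1, 0)" "(1, 0)" "(0, 1)"]
      C[of "(1, 0)" "(0, 1)" "(0, 1)"] C[of "(0, 1)" "(0, 1)" "(0, 1)"]
    by (simp add: \<gamma> frame_metric_def skew_def)
qed

subsection \<open>Levi-Civita, dual and Amari--Chentsov connections\<close>

text \<open>Differentiates the Christoffel term of a connection and the skewness operator, both of
  which have this shape.\<close>

lemma has_derivative_inverse_snd_scaleR:
  assumes "bounded_bilinear B" "smooth_on normal_family Y" "smooth_on normal_family Z" "snd p > 0"
  shows "((\<lambda>q. (1 / snd q) *\<^sub>R B (Y q) (Z q)) has_derivative
    (\<lambda>u. (1 / snd p) *\<^sub>R (B (Y p) (frechet_derivative Z (at p) u) + B (frechet_derivative Y (at p) u) (Z p))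
      - (snd u / (snd p)\<^sup>2) *\<^sub>R B (Y p) (Z p))) (at p)"
proof -
  have p: "p \<in> normal_family" using assms by (simp add: mem_normal_family)
  have 1: "((\<lambda>q::real \<times> real. 1 / snd q) has_derivative (\<lambda>u. - snd u / (snd p)\<^sup>2)) (at p)"
    using assms(4) by (auto intro!: derivative_eq_intros simp: fun_eq_iff power2_eq_square field_simps)
  have 2: "((\<lambda>q. B (Y q) (Z q)) has_derivative
      (\<lambda>u. B (Y p) (frechet_derivative Z (at p) u) + B (frechet_derivative Y (at p) u) (Z p))) (at p)"
    by (intro bounded_bilinear.FDERIV[OF assms(1)] smooth_on_has_derivative[OF _ p] assms)
  show ?thesis
    using has_derivative_scaleR[OF 1 2] by simp
qed

lemma smooth_on_has_christoffel:
  assumes "has_christoffel \<gamma> nab" "smooth_on normal_family X" "smooth_on normal_family Y"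
  shows "smooth_on normal_family (nab X Y)"
proof -
  note N = open_normal_family
  have "bounded_bilinear \<gamma>" using assms(1) by (simp add: has_christoffel_def)
  then have "smooth_on normal_family (\<lambda>p. \<gamma> (X p) (Y p))"
    by (rule smooth_on_bilinear[OF _ N assms(2,3)])
  then have "smooth_on normal_family (\<lambda>p. frechet_derivative Y (at p) (X p) + (1 / snd p) *\<^sub>R \<gamma> (X p) (Y p))"
    by (intro smooth_on_intros N assms) (simp_all add: mem_normal_family)
  then show ?thesis
    by (subst smooth_on_cong[OF N]) (simp_all add: has_christoffelD[OF assms] mem_normal_family)
qed

text \<open>The flat derivative carries the Leibniz rule, and the added term is bilinear over
  functions. This supplies the witness for the existence of the Levi-Civita connection.\<close>

lemma affine_connection_christoffel:
  assumes \<gamma>: "bounded_bilinear \<gamma>"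
  defines "nab \<equiv> \<lambda>X Y p. frechet_derivative Y (at p) (X p) + (1 / snd p) *\<^sub>R \<gamma> (X p) (Y p)"
  shows "affine_connection normal_family nab" "has_christoffel \<gamma> nab"
proof -
  interpret \<gamma>: bounded_bilinear \<gamma> by fact
  show chr: "has_christoffel \<gamma> nab"
    using \<gamma> by (simp add: has_christoffel_def nab_def)
  note D = smooth_on_has_derivative and L = smooth_on_linear_derivative
  show "affine_connection normal_family nab"
    unfolding affine_connection_def vector_fields_iff
  proof (intro conjI ballI allI impI; unfold vector_fields_iff)
    fix X Y :: "(real \<times> real) vfield"
    assume "smooth_on normal_family X" "smooth_on normal_family Y"
    then show "smooth_on normal_family (nab X Y)"
      by (rule smooth_on_has_christoffel[OF chr])
  next
    fix X X' Y :: "(real \<times> real) vfield" and p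
    assume "smooth_on normal_family Y" "p \<in> normal_family"
    from L[OF this] show "nab (\<lambda>q. X q + X' q) Y p = nab X Y p + nab X' Y p"
      by (simp add: nab_def linear_add \<gamma>.add_left scaleR_right_distrib)
  next
    fix X Y Y' :: "(real \<times> real) vfield" and p
    assume "smooth_on normal_family Y" "smooth_on normal_family Y'" "p \<in> normal_family"
    from frechet_derivative_at[OF has_derivative_add[OF D[OF this(1,3)] D[OF this(2,3)]]]
    show "nab X (\<lambda>q. Y q + Y' q) p = nab X Y p + nab X Y' p"
      by (simp only: nab_def \<gamma>.add_right scaleR_right_distrib) (metis (no_types, lifting) add.assoc add.left_commute)
  next
    fix f :: "real \<times> real \<Rightarrow> real" and X Y :: "(real \<times> real) vfield" and p
    assume "smooth_on normal_family Y" "p \<in> normal_family"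
    from L[OF this] show "nab (\<lambda>q. f q *\<^sub>R X q) Y p = f p *\<^sub>R nab X Y p"
      by (simp add: nab_def linear_cmul \<gamma>.scaleR_left scaleR_right_distrib mult.commute)
  next
    fix f :: "real \<times> real \<Rightarrow> real" and X Y :: "(real \<times> real) vfield" and p
    assume "smooth_on normal_family f" "smooth_on normal_family Y" "p \<in> normal_family"
    from frechet_derivative_at[OF has_derivative_scaleR[OF D[OF this(1,3)] D[OF this(2,3)]], symmetric]
    have "frechet_derivative (\<lambda>q. f q *\<^sub>R Y q) (at p) (X p) =
        f p *\<^sub>R frechet_derivative Y (at p) (X p) + frechet_derivative f (at p) (X p) *\<^sub>R Y p"
      by (rule fun_cong)
    then show "nab X (\<lambda>q. f q *\<^sub>R Y q) p = f p *\<^sub>R nab X Y p + along X f p *\<^sub>R Y p"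
      by (simp add: nab_def along_def \<gamma>.scaleR_right scaleR_right_distrib mult.commute)
  qed
qed

lemma christoffel_commute: "christoffel a b c d u v = christoffel a b c d v u"
  by (simp add: christoffel_def skew_def algebra_simps)

lemma cubic_form_christoffel:
  assumes "has_christoffel (christoffel a b c d) nab"
    and "smooth_on normal_family X" "smooth_on normal_family Y" "smooth_on normal_family Z" "snd p > 0"
  shows "cubic_form fisher_metric nab X Y Z p = frame_metric (skew a b c d (X p) (Y p)) (Z p) / snd p ^ 3"
  using assms by (subst cubic_form_at[where \<gamma>="christoffel a b c d"])
    (auto simp: has_christoffelD frame_cubic_christoffel)

text \<open>Constant fields at the identity, where the height is \<open>1\<close>, recover
  \<open>frame_cubic\<close> from the cubic form.\<close>

lemma frame_cubic_commute:
  assumes "totally_symmetric3 normal_family (cubic_form fisher_metric nab)" "has_christoffel \<gamma> nab"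
  shows "frame_cubic \<gamma> u v w = frame_cubic \<gamma> v u w"
proof -
  have smooth: "smooth_on normal_family (\<lambda>_. u)" for u :: "real \<times> real"
    by (rule smooth_on_const[OF open_normal_family])
  have "cubic_form fisher_metric nab (\<lambda>_. u) (\<lambda>_. v) (\<lambda>_. w) (0, 1) = frame_cubic \<gamma> u v w" for u v w
    using cubic_form_at[OF smooth smooth, of "(0, 1)" nab "\<lambda>_. u" v \<gamma> w] has_christoffelD[OF assms(2) smooth smooth, of "(0, 1)"]
    by simp
  moreover have "cubic_form fisher_metric nab (\<lambda>_. u) (\<lambda>_. v) (\<lambda>_. w) (0, 1) =
      cubic_form fisher_metric nab (\<lambda>_. v) (\<lambda>_. u) (\<lambda>_. w) (0, 1)"
    using assms(1) smooth unfolding totally_symmetric3_def by (simp add: vector_fields_iff mem_normal_family)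
  ultimately show ?thesis by simp
qed

text \<open>Left-invariance provides \<open>\<gamma>\<close>, torsion-freeness on commuting constant
  fields makes it symmetric, and symmetry of the cubic form leaves the four parameters.\<close>

lemma statistical_has_christoffel:
  assumes "statistical_lie_group affine_group fisher_metric nab"
  obtains a b c d where "has_christoffel (christoffel a b c d) nab"
proof -
  have nab: "affine_connection normal_family nab" "torsion_free normal_family nab"
    "totally_symmetric3 normal_family (cubic_form fisher_metric nab)" "left_invariant_connection affine_group nab"
    using assms by (auto simp: statistical_lie_group_def statistical_structure_def)
  define \<gamma> where "\<gamma> = (\<lambda>u v. nab (\<lambda>_. u) (\<lambda>_. v) (0, 1))"
  have chr: "has_christoffel \<gamma> nab"
    unfolding \<gamma>_def using left_invariant_has_christoffel[OF nab(1,4)] .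
  have "\<gamma> u v = \<gamma> v u" for u v
  proof -
    have "nab (\<lambda>_. u) (\<lambda>_. v) (0, 1) - nab (\<lambda>_. v) (\<lambda>_. u) (0, 1) = lie_bracket (\<lambda>_. u) (\<lambda>_. v) (0, 1)"
      using nab(2) unfolding torsion_free_def
      by (simp add: vector_fields_iff smooth_on_const[OF open_normal_family] mem_normal_family)
    then show ?thesis by (simp add: \<gamma>_def lie_bracket_def frechet_derivative_const)
  qed
  moreover have "bounded_bilinear \<gamma>" using chr by (simp add: has_christoffel_def)
  ultimately obtain a b c d where "\<gamma> = christoffel a b c d"
    using symmetric_frame_cubic_imp_christoffel frame_cubic_commute[OF nab(3) chr] by metis
  then show ?thesis using that chr by blast
qed

text \<open>\<open>levi_civita\<close> is a choice, so a witness must be given: the connection with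
  \<open>K = 0\<close>.\<close>

lemma levi_civita_connection_exists:
  "\<exists>nab. levi_civita_connection normal_family fisher_metric nab"
proof -
  let ?\<gamma> = "christoffel 0 0 0 0"
  let ?nab = "\<lambda>X Y p. frechet_derivative Y (at p) (X p) + (1 / snd p) *\<^sub>R ?\<gamma> (X p) (Y p)"
  note nab = affine_connection_christoffel[OF bounded_bilinear_christoffel, of 0 0 0 0]
  have "levi_civita_connection normal_family fisher_metric ?nab"
    unfolding levi_civita_connection_def
  proof (intro conjI ballI)
    show "torsion_free normal_family ?nab"
      unfolding torsion_free_def lie_bracket_def by (simp add: christoffel_commute[of 0 0 0 0])
    fix X Y Z :: "(real \<times> real) vfield" and p
    assume "X \<in> vector_fields normal_family" "Y \<in> vector_fields normal_family"
      "Z \<in> vector_fields normal_family" "p \<in> normal_family"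
    then show "cubic_form fisher_metric ?nab X Y Z p = 0"
      by (simp add: cubic_form_christoffel[OF nab(2)] vector_fields_iff mem_normal_family skew_def frame_metric_def)
  qed (rule nab(1))
  then show ?thesis by blast
qed

text \<open>The chosen connection is not assumed left-invariant. Uniqueness is applied at each point
  separately instead, and the outcome has constant symbols up to the factor
  \<open>1 / snd p\<close>.\<close>

lemma has_christoffel_levi_civita:
  "has_christoffel (christoffel 0 0 0 0) (levi_civita normal_family fisher_metric)"
proof -
  let ?nab = "levi_civita normal_family fisher_metric"
  note N = open_normal_family
  have "levi_civita_connection normal_family fisher_metric ?nab"
    unfolding levi_civita_def by (rule someI_ex[OF levi_civita_connection_exists])
  then have nab: "affine_connection normal_family ?nab" "torsion_free normal_family ?nab"
    and C: "cubic_form fisher_metric ?nab (\<lambda>_. u) (\<lambda>_. v) (\<lambda>_. w) p = 0" if "p \<in> normal_family" for u v w p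
    using that by (auto simp: levi_civita_connection_def vector_fields_iff smooth_on_const[OF N])
  have "?nab (\<lambda>_. u) (\<lambda>_. v) p = (1 / snd p) *\<^sub>R christoffel 0 0 0 0 u v" if p: "p \<in> normal_family" for u v p
  proof -
    have y: "snd p > 0" using p by (simp add: mem_normal_family)
    \<comment> \<open>Rescaling by the height reduces the condition at \<open>p\<close> to the one
      at the identity.\<close>
    define \<gamma> where "\<gamma> = (\<lambda>u v. snd p *\<^sub>R ?nab (\<lambda>_. u) (\<lambda>_. v) p)"
    have nab\<gamma>: "?nab (\<lambda>_. u) (\<lambda>_. v) p = (1 / snd p) *\<^sub>R \<gamma> u v" for u v
      using y by (simp add: \<gamma>_def)
    have "bilinear \<gamma>"
      using bilinear_affine_connection_const[OF N nab(1)[OF p] p]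
      by (simp add: \<gamma>_def bilinear_def linear_iff algebra_simps)
    then have "bounded_bilinear \<gamma>" by (simp add: bilinear_conv_bounded_bilinear)
    moreover have "\<gamma> u v = \<gamma> v u" for u v
    proof -
      have "?nab (\<lambda>_. u) (\<lambda>_. v) p - ?nab (\<lambda>_. v) (\<lambda>_. u) p = lie_bracket (\<lambda>_. u) (\<lambda>_. v) p"
        using nab(2)[OF p] p unfolding torsion_free_def by (simp add: vector_fields_iff smooth_on_const[OF N])
      then show ?thesis by (simp add: \<gamma>_def lie_bracket_def frechet_derivative_const)
    qed
    moreover have "frame_cubic \<gamma> u v w = 0" for u v w
    proof -
      have "cubic_form fisher_metric ?nab (\<lambda>_. u) (\<lambda>_. v) (\<lambda>_. w) p = frame_cubic \<gamma> u v w / snd p ^ 3"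
        by (rule cubic_form_at) (simp_all add: smooth_on_const[OF N] y nab\<gamma> frechet_derivative_const)
      with C[OF p] y show ?thesis by simp
    qed
    ultimately have "\<gamma> = christoffel 0 0 0 0" by (rule frame_cubic_zero_imp_christoffel)
    with nab\<gamma> show ?thesis by simp
  qed
  then show ?thesis
    using affine_connection_flat_coordinates[OF N nab(1)]
    by (simp add: has_christoffel_def vector_fields_iff bounded_bilinear_christoffel)
qed

lemma fisher_metric_eqD:
  assumes "snd p > 0" "\<And>v. fisher_metric p u v = fisher_metric p w v"
  shows "u = w"
  using assms by (subst frame_metric_eq_iff[symmetric]) (simp add: fisher_metric_frame)

text \<open>Duality in the frame: the terms in \<open>K\<close> cancel since \<open>K\<close> is
  self-adjoint, and the rest says that the Levi-Civita part is metric.\<close>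

lemma christoffel_dual:
  "frame_metric (christoffel a b c d u v) w + frame_metric v (christoffel (-a) (-b) (-c) (-d) u w) =
    - 2 * snd u * frame_metric v w"
  unfolding frame_metric_def christoffel_def skew_def by (simp add: field_simps)

text \<open>The candidate satisfies the defining identity, and testing with constant fields against
  the nondegenerate metric shows it to be the only one.\<close>

lemma has_christoffel_dual:
  assumes "has_christoffel (christoffel a b c d) nab"
  shows "has_christoffel (christoffel (-a) (-b) (-c) (-d)) (dual_connection normal_family fisher_metric nab)"
proof -
  interpret frame: bounded_bilinear frame_metric by (rule bounded_bilinear_frame_metric)
  have "dual_connection normal_family fisher_metric nab X Z p =
      frechet_derivative Z (at p) (X p) + (1 / snd p) *\<^sub>R christoffel (-a) (-b) (-c) (-d) (X p) (Z p)" (is "_ = ?w")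
    if X: "smooth_on normal_family X" and Z: "smooth_on normal_family Z" and p: "snd p > 0" for X Z p
  proof -
    have eq: "along X (metric_app fisher_metric Y Z) p = metric_app fisher_metric (nab X Y) Z p + fisher_metric p (Y p) ?w"
      if Y: "smooth_on normal_family Y" for Y
    proof -
      have "along X (metric_app fisher_metric Y Z) p =
        (frame_metric (Y p) (frechet_derivative Z (at p) (X p)) + frame_metric (frechet_derivative Y (at p) (X p)) (Z p)) / (snd p)\<^sup>2
        + (frame_metric (christoffel a b c d (X p) (Y p)) (Z p) + frame_metric (Y p) (christoffel (-a) (-b) (-c) (-d) (X p) (Z p))) / (snd p) ^ 3"
        unfolding christoffel_dual along_metric_app_fisher[OF Y Z p] by simp
      also have "\<dots> = metric_app fisher_metric (nab X Y) Z p + fisher_metric p (Y p) ?w"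
        unfolding metric_app_def has_christoffelD[OF assms X Y p] fisher_metric_frame[OF p]
          frame.add_left frame.add_right frame.scaleR_left frame.scaleR_right
        using p by (simp add: field_simps power2_eq_square power3_eq_cube)
      finally show ?thesis .
    qed
    show ?thesis
      unfolding dual_connection_def
    proof (rule the_equality)
      fix w
      assume *: "\<forall>Y\<in>vector_fields normal_family. along X (metric_app fisher_metric Y Z) p =
        metric_app fisher_metric (nab X Y) Z p + fisher_metric p (Y p) w"
      have "fisher_metric p v w = fisher_metric p v ?w" for v
        using *[rule_format, of "\<lambda>_. v"] eq[of "\<lambda>_. v"]
        by (simp add: vector_fields_iff smooth_on_const[OF open_normal_family])
      then show "w = ?w"
        using p by (intro fisher_metric_eqD[OF p]) (simp add: fisher_metric_eq mult.commute)
    qed (use eq in \<open>simp add: vector_fields_iff\<close>)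
  qed
  then show ?thesis
    by (simp add: has_christoffel_def vector_fields_iff mem_normal_family bounded_bilinear_christoffel)
qed

text \<open>The cubic form has weight 3 in the height and the metric weight 2, which leaves a single
  factor \<open>1 / snd p\<close> for \<open>K\<close>.\<close>

lemma skewness_eq:
  assumes "has_christoffel (christoffel a b c d) nab"
    and "smooth_on normal_family X" "smooth_on normal_family Y" "snd p > 0"
  shows "skewness normal_family fisher_metric nab X Y p = (1 / snd p) *\<^sub>R skew a b c d (X p) (Y p)" (is "_ = ?k")
proof -
  interpret frame: bounded_bilinear frame_metric by (rule bounded_bilinear_frame_metric)
  have eq: "fisher_metric p ?k (Z p) = cubic_form fisher_metric nab X Y Z p" if "smooth_on normal_family Z" for Z
    using assms(4) unfolding cubic_form_christoffel[OF assms(1-3) that assms(4)]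
    by (simp add: fisher_metric_frame frame.scaleR_left power2_eq_square power3_eq_cube)
  show ?thesis
    unfolding skewness_def
  proof (rule the_equality)
    fix k
    assume *: "\<forall>Z\<in>vector_fields normal_family. fisher_metric p k (Z p) = cubic_form fisher_metric nab X Y Z p"
    have "fisher_metric p k v = fisher_metric p ?k v" for v
      using *[rule_format, of "\<lambda>_. v"] eq[of "\<lambda>_. v"]
      by (simp add: vector_fields_iff smooth_on_const[OF open_normal_family])
    then show "k = ?k" by (rule fisher_metric_eqD[OF assms(4)])
  qed (use eq in \<open>simp add: vector_fields_iff\<close>)
qed

text \<open>At the identity the components of \<open>fisher_cubic\<close> are 0, 2, 0, 8; the
  connection is the one whose cubic form is \<open>\<alpha>\<close> times this.\<close>

lemma has_christoffel_amari_chentsov: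
  "has_christoffel (christoffel 0 (2 * \<alpha>) 0 (8 * \<alpha>)) (amari_chentsov \<alpha>)"
proof -
  interpret frame: bounded_bilinear frame_metric by (rule bounded_bilinear_frame_metric)
  let ?\<gamma> = "christoffel 0 (2 * \<alpha>) 0 (8 * \<alpha>)"
  have "amari_chentsov \<alpha> X Y p = frechet_derivative Y (at p) (X p) + (1 / snd p) *\<^sub>R ?\<gamma> (X p) (Y p)" (is "_ = ?w")
    if X: "smooth_on normal_family X" and Y: "smooth_on normal_family Y" and p: "snd p > 0" for X Y p
  proof -
    have key: "frame_metric (?\<gamma> u v) w = frame_metric (christoffel 0 0 0 0 u v) w -
        \<alpha> / 2 * (snd p ^ 3 * fisher_cubic p u v w)" for u v w
      using p unfolding fisher_cubic_eq[OF p] frame_metric_def christoffel_def skew_def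
      by (simp add: field_simps)
    have eq: "fisher_metric p ?w v = fisher_metric p (levi_civita normal_family fisher_metric X Y p) v
        - \<alpha> / 2 * fisher_cubic p (X p) (Y p) v" for v
      unfolding has_christoffelD[OF has_christoffel_levi_civita X Y p] fisher_metric_frame[OF p]
        frame.add_left frame.scaleR_left key
      using p by (simp add: field_simps power2_eq_square power3_eq_cube)
    show ?thesis
      unfolding amari_chentsov_def
      by (rule the_equality) (auto simp: eq intro: fisher_metric_eqD[OF p])
  qed
  then show ?thesis
    by (simp add: has_christoffel_def vector_fields_iff mem_normal_family bounded_bilinear_christoffel)
qed

lemma has_christoffel_eq_iff:
  assumes "has_christoffel \<gamma> nab" "has_christoffel \<gamma>' nab'"
  shows "(\<forall>X\<in>vector_fields normal_family. \<forall>Y\<in>vector_fields normal_family. \<forall>p\<in>normal_family.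
    nab X Y p = nab' X Y p) \<longleftrightarrow> \<gamma> = \<gamma>'"
proof
  assume eq: "\<forall>X\<in>vector_fields normal_family. \<forall>Y\<in>vector_fields normal_family. \<forall>p\<in>normal_family.
    nab X Y p = nab' X Y p"
  have smooth: "smooth_on normal_family (\<lambda>_. u)" for u :: "real \<times> real"
    by (rule smooth_on_const[OF open_normal_family])
  have "\<gamma> u v = \<gamma>' u v" for u v
    using eq[rule_format, of "\<lambda>_. u" "\<lambda>_. v" "(0, 1)"]
      has_christoffelD[OF assms(1) smooth smooth, of "(0, 1)" u v]
      has_christoffelD[OF assms(2) smooth smooth, of "(0, 1)" u v]
    by (simp add: vector_fields_iff smooth mem_normal_family)
  then show "\<gamma> = \<gamma>'" by blast
qed (use has_christoffelD[OF assms(1)] has_christoffelD[OF assms(2)] in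
    \<open>simp add: vector_fields_iff mem_normal_family\<close>)

subsection \<open>Covariant derivatives and curvature in the left-invariant frame\<close>

text \<open>The covariant derivative of the cubic form at the identity; the term with factor 3 comes
  from its weight in the height. The symbols \<open>\<gamma>\<close> are separate from the
  parameters so that both \<nabla>C and \<open>\<nabla>\<^sup>gC\<close> are covered.\<close>

definition frame_deriv_cubic ::
  "(real \<times> real \<Rightarrow> real \<times> real \<Rightarrow> real \<times> real) \<Rightarrow> real \<Rightarrow> real \<Rightarrow> real \<Rightarrow> real \<Rightarrow>
    real \<times> real \<Rightarrow> real \<times> real \<Rightarrow> real \<times> real \<Rightarrow> real \<times> real \<Rightarrow> real" where
  "frame_deriv_cubic \<gamma> a b c d u v w z =
    - 3 * snd u * frame_metric (skew a b c d v w) z - frame_metric (skew a b c d (\<gamma> u v) w) z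
    - frame_metric (skew a b c d v (\<gamma> u w)) z - frame_metric (skew a b c d v w) (\<gamma> u z)"

text \<open>The result is tensorial: derivatives of \<open>Y\<close>, \<open>Z\<close>,
  \<open>W\<close> cancel against the flat parts of \<open>nab'\<close>, and differentiation raises
  the weight from 3 to 4.\<close>

lemma cov_deriv_cubic_form:
  assumes nab: "has_christoffel (christoffel a b c d) nab" and nab': "has_christoffel \<gamma> nab'"
    and X: "smooth_on normal_family X" and Y: "smooth_on normal_family Y"
    and Z: "smooth_on normal_family Z" and W: "smooth_on normal_family W" and p: "snd p > 0"
  shows "cov_deriv_03 nab' (cubic_form fisher_metric nab) X Y Z W p =
    frame_deriv_cubic \<gamma> a b c d (X p) (Y p) (Z p) (W p) / snd p ^ 4"
proof -
  interpret frame: bounded_bilinear frame_metric by (rule bounded_bilinear_frame_metric)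
  interpret skew: bounded_bilinear "skew a b c d" by (rule bounded_bilinear_skew)
  have pN: "p \<in> normal_family" using p by (simp add: mem_normal_family)
  note C = cubic_form_christoffel[OF nab]
  let ?D = "\<lambda>Y u. frechet_derivative Y (at p) u"
  let ?dC = "\<lambda>u. frame_metric (skew a b c d (Y p) (Z p)) (?D W u)
    + frame_metric (skew a b c d (Y p) (?D Z u) + skew a b c d (?D Y u) (Z p)) (W p)"
  have "((\<lambda>q. frame_metric (skew a b c d (Y q) (Z q)) (W q)) has_derivative ?dC) (at p)"
    using smooth_on_has_derivative[OF Y pN] smooth_on_has_derivative[OF Z pN] smooth_on_has_derivative[OF W pN]
    by (intro frame.FDERIV skew.FDERIV)
  moreover have "along X (cubic_form fisher_metric nab Y Z W) p =
      along X (\<lambda>q. frame_metric (skew a b c d (Y q) (Z q)) (W q) / snd q ^ Suc 2) p"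
    unfolding along_def
    by (subst frechet_derivative_cong_open[OF open_normal_family pN])
      (auto simp: C[OF Y Z W] mem_normal_family)
  ultimately have "along X (cubic_form fisher_metric nab Y Z W) p = ?dC (X p) / snd p ^ Suc 2
      - real (Suc 2) * snd (X p) * frame_metric (skew a b c d (Y p) (Z p)) (W p) / snd p ^ Suc (Suc 2)"
    using p by (simp only: along_divide_power less_imp_neq[symmetric] not_False_eq_True)
  then have D: "along X (cubic_form fisher_metric nab Y Z W) p = ?dC (X p) / snd p ^ 3
      - 3 * snd (X p) * frame_metric (skew a b c d (Y p) (Z p)) (W p) / snd p ^ 4"
    by (simp add: eval_nat_numeral)
  have y4: "snd p ^ 4 = snd p * snd p ^ 3"
    by (simp add: eval_nat_numeral)
  note S = smooth_on_has_christoffel[OF nab' X]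
  show ?thesis
    unfolding cov_deriv_03_def D C[OF S[OF Y] Z W p] C[OF Y S[OF Z] W p] C[OF Y Z S[OF W] p]
      has_christoffelD[OF nab' X Y p] has_christoffelD[OF nab' X Z p] has_christoffelD[OF nab' X W p]
      frame.add_left frame.add_right frame.scaleR_left frame.scaleR_right
      skew.add_left skew.add_right skew.scaleR_left skew.scaleR_right frame_deriv_cubic_def
      add_divide_distrib diff_divide_distrib y4
    by simp
qed

text \<open>The value of \<open>\<nabla>\<^sup>gK\<close> at the identity; the term with
  \<open>snd u\<close> is the derivative of the factor \<open>1 / snd p\<close> of
  \<open>K\<close>.\<close>

definition frame_deriv_skew ::
  "real \<Rightarrow> real \<Rightarrow> real \<Rightarrow> real \<Rightarrow> real \<times> real \<Rightarrow> real \<times> real \<Rightarrow> real \<times> real \<Rightarrow> real \<times> real" where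
  "frame_deriv_skew a b c d u v w =
    christoffel 0 0 0 0 u (skew a b c d v w) - snd u *\<^sub>R skew a b c d v w
    - skew a b c d (christoffel 0 0 0 0 u v) w - skew a b c d v (christoffel 0 0 0 0 u w)"

lemma cov_deriv_skewness:
  assumes nab: "has_christoffel (christoffel a b c d) nab"
    and X: "smooth_on normal_family X" and Y: "smooth_on normal_family Y"
    and Z: "smooth_on normal_family Z" and p: "snd p > 0"
  shows "cov_deriv_12 (levi_civita normal_family fisher_metric) (skewness normal_family fisher_metric nab) X Y Z p =
    (1 / (snd p)\<^sup>2) *\<^sub>R frame_deriv_skew a b c d (X p) (Y p) (Z p)"
proof -
  let ?LC = "levi_civita normal_family fisher_metric" and ?K = "skewness normal_family fisher_metric nab"
  interpret \<gamma>: bounded_bilinear "christoffel 0 0 0 0" by (rule bounded_bilinear_christoffel)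
  interpret skew: bounded_bilinear "skew a b c d" by (rule bounded_bilinear_skew)
  have pN: "p \<in> normal_family" using p by (simp add: mem_normal_family)
  note K = skewness_eq[OF nab] and LC = has_christoffel_levi_civita
  have K_eq: "?K Y Z q = (1 / snd q) *\<^sub>R skew a b c d (Y q) (Z q)" if "q \<in> normal_family" for q
    using that by (intro K Y Z) (simp add: mem_normal_family)
  have "smooth_on normal_family (\<lambda>q. (1 / snd q) *\<^sub>R skew a b c d (Y q) (Z q))"
    by (intro smooth_on_intros smooth_on_bilinear[OF bounded_bilinear_skew] Y Z open_normal_family)
      (auto simp: mem_normal_family)
  \<comment> \<open>The formula for the connection applies to smooth fields only, so
    \<open>K(Y, Z)\<close> must be one before it is differentiated.\<close>
  then have KS: "smooth_on normal_family (?K Y Z)"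
    by (subst smooth_on_cong[OF open_normal_family K_eq])
  have DK: "frechet_derivative (?K Y Z) (at p) = (\<lambda>u. (1 / snd p) *\<^sub>R (skew a b c d (Y p) (frechet_derivative Z (at p) u)
      + skew a b c d (frechet_derivative Y (at p) u) (Z p)) - (snd u / (snd p)\<^sup>2) *\<^sub>R skew a b c d (Y p) (Z p))"
    by (rule trans[OF frechet_derivative_cong_open[OF open_normal_family pN]], erule K_eq)
      (rule frechet_derivative_at[OF has_derivative_inverse_snd_scaleR[OF bounded_bilinear_skew Y Z p], symmetric])
  note S = smooth_on_has_christoffel[OF LC X]
  show ?thesis
    unfolding cov_deriv_12_def has_christoffelD[OF LC X KS p] DK K_eq[OF pN] K[OF S[OF Y] Z p] K[OF Y S[OF Z] p]
      has_christoffelD[OF LC X Y p] has_christoffelD[OF LC X Z p] frame_deriv_skew_def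
      skew.add_left skew.add_right skew.scaleR_left skew.scaleR_right \<gamma>.scaleR_right
    by (simp add: algebra_simps power2_eq_square)
qed

text \<open>The curvature at the identity on constant fields; the first two terms come from
  differentiating the factor \<open>1 / snd p\<close> of the symbols.\<close>

definition frame_curvature ::
  "(real \<times> real \<Rightarrow> real \<times> real \<Rightarrow> real \<times> real) \<Rightarrow> real \<times> real \<Rightarrow> real \<times> real \<Rightarrow> real \<times> real \<Rightarrow> real \<times> real"
  where
  "frame_curvature \<gamma> u v w =
    snd v *\<^sub>R \<gamma> u w - snd u *\<^sub>R \<gamma> v w + \<gamma> u (\<gamma> v w) - \<gamma> v (\<gamma> u w)"

text \<open>The second derivatives of \<open>Z\<close> are kept unevaluated: they do not depend on the connection, so
  they cancel when two connections are compared.\<close>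

lemma curvature_has_christoffel:
  assumes nab: "has_christoffel \<gamma> nab"
    and X: "smooth_on normal_family X" and Y: "smooth_on normal_family Y"
    and Z: "smooth_on normal_family Z" and p: "snd p > 0"
  shows "curvature nab X Y Z p =
    frechet_derivative (\<lambda>q. frechet_derivative Z (at q) (Y q)) (at p) (X p)
    - frechet_derivative (\<lambda>q. frechet_derivative Z (at q) (X q)) (at p) (Y p)
    - frechet_derivative Z (at p) (lie_bracket X Y p)
    + (1 / (snd p)\<^sup>2) *\<^sub>R frame_curvature \<gamma> (X p) (Y p) (Z p)"
proof -
  have \<gamma>: "bounded_bilinear \<gamma>" using nab by (simp add: has_christoffel_def)
  interpret \<gamma>: bounded_bilinear \<gamma> by (rule \<gamma>)
  have pN: "p \<in> normal_family" using p by (simp add: mem_normal_family)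
  note N = open_normal_family
  let ?D = "\<lambda>Y u. frechet_derivative Y (at p) u"
  \<comment> \<open>Stated for arbitrary fields because it is used for both orders of
    \<open>X\<close> and \<open>Y\<close>.\<close>
  have nn: "nab X (nab Y Z) p = ?D (\<lambda>q. frechet_derivative Z (at q) (Y q)) (X p)
      + (1 / snd p) *\<^sub>R (\<gamma> (Y p) (?D Z (X p)) + \<gamma> (?D Y (X p)) (Z p))
      - (snd (X p) / (snd p)\<^sup>2) *\<^sub>R \<gamma> (Y p) (Z p)
      + (1 / snd p) *\<^sub>R \<gamma> (X p) (?D Z (Y p)) + (1 / (snd p)\<^sup>2) *\<^sub>R \<gamma> (X p) (\<gamma> (Y p) (Z p))"
    if X: "smooth_on normal_family X" and Y: "smooth_on normal_family Y" for X Y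
  proof -
    note S = smooth_on_has_christoffel[OF nab Y Z]
    have "frechet_derivative (nab Y Z) (at p) = frechet_derivative (\<lambda>q. frechet_derivative Z (at q) (Y q)
        + (1 / snd q) *\<^sub>R \<gamma> (Y q) (Z q)) (at p)"
      by (rule frechet_derivative_cong_open[OF N pN]) (use nab Y Z in \<open>simp add: has_christoffelD mem_normal_family\<close>)
    also have "\<dots> = (\<lambda>u. ?D (\<lambda>q. frechet_derivative Z (at q) (Y q)) u +
      ((1 / snd p) *\<^sub>R (\<gamma> (Y p) (?D Z u) + \<gamma> (?D Y u) (Z p)) - (snd u / (snd p)\<^sup>2) *\<^sub>R \<gamma> (Y p) (Z p)))"
      by (intro frechet_derivative_at[symmetric] has_derivative_add has_derivative_inverse_snd_scaleR[OF \<gamma> Y Z p]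
          smooth_on_has_derivative[OF smooth_on_frechet_derivative[OF N Z Y] pN])
    finally show ?thesis
      unfolding has_christoffelD[OF nab X S p] has_christoffelD[OF nab Y Z p] \<gamma>.add_right \<gamma>.scaleR_right
      by (simp add: algebra_simps power2_eq_square)
  qed
  have br: "smooth_on normal_family (lie_bracket X Y)"
    unfolding lie_bracket_def by (intro smooth_on_intros N X Y)
  show ?thesis
    \<comment> \<open>Terms with derivatives of \<open>Z\<close> inside \<open>\<gamma>\<close> are
      symmetric in \<open>X\<close>, \<open>Y\<close> and drop out; those with derivatives of
      \<open>X\<close> and \<open>Y\<close> add up to the bracket and cancel with the last term of
      the curvature.\<close>
    unfolding curvature_def nn[OF X Y] nn[OF Y X] has_christoffelD[OF nab br Z p] frame_curvature_def
    unfolding lie_bracket_def \<gamma>.diff_left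
    by (simp add: algebra_simps)
qed

lemma curvature_eq_frame_iff:
  assumes "has_christoffel \<gamma> nab" "has_christoffel \<gamma>' nab'"
  shows "(\<forall>X\<in>vector_fields normal_family. \<forall>Y\<in>vector_fields normal_family.
      \<forall>Z\<in>vector_fields normal_family. \<forall>p\<in>normal_family. curvature nab X Y Z p = curvature nab' X Y Z p) \<longleftrightarrow>
    (\<forall>u v w. frame_curvature \<gamma> u v w = frame_curvature \<gamma>' u v w)"
    (is "?L \<longleftrightarrow> ?R")
proof
  assume L: ?L
  have smooth: "smooth_on normal_family (\<lambda>_. u)" for u :: "real \<times> real"
    by (rule smooth_on_const[OF open_normal_family])
  show ?R
  proof (intro allI)
    fix u v w
    have "curvature nab (\<lambda>_. u) (\<lambda>_. v) (\<lambda>_. w) (0, 1) = curvature nab' (\<lambda>_. u) (\<lambda>_. v) (\<lambda>_. w) (0, 1)"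
      using L by (simp add: vector_fields_iff smooth mem_normal_family)
    then show "frame_curvature \<gamma> u v w = frame_curvature \<gamma>' u v w"
      by (simp add: curvature_has_christoffel[OF assms(1)] curvature_has_christoffel[OF assms(2)] smooth)
  qed
next
  assume R: ?R
  show ?L
  proof (intro ballI)
    fix X Y Z :: "(real \<times> real) vfield" and p
    assume "X \<in> vector_fields normal_family" "Y \<in> vector_fields normal_family"
      "Z \<in> vector_fields normal_family" "p \<in> normal_family"
    note * = this[unfolded vector_fields_iff mem_normal_family]
    show "curvature nab X Y Z p = curvature nab' X Y Z p"
      using R by (simp only: curvature_has_christoffel[OF assms(1) *] curvature_has_christoffel[OF assms(2) *])
  qed
qed

section \<open>Reduction of tensor symmetry to the identity element\<close>

text \<open>Up to a power of the height, the tensor is the same multilinear expression at every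
  point, so constant fields at the identity already detect its symmetry.\<close>

lemma totally_symmetric4_frame_iff:
  assumes "\<And>X Y Z W p. smooth_on normal_family X \<Longrightarrow> smooth_on normal_family Y \<Longrightarrow>
      smooth_on normal_family Z \<Longrightarrow> smooth_on normal_family W \<Longrightarrow> snd p > 0 \<Longrightarrow>
      F X Y Z W p = T (X p) (Y p) (Z p) (W p) / snd p ^ n"
  shows "totally_symmetric4 normal_family F \<longleftrightarrow>
    (\<forall>u v w z. T u v w z = T v u w z \<and> T u v w z = T u w v z \<and> T u v w z = (T u v z w :: real))"
    (is "?L \<longleftrightarrow> ?R")
proof
  have smooth: "smooth_on normal_family (\<lambda>_. u)" for u :: "real \<times> real"
    by (rule smooth_on_const[OF open_normal_family])
  have F: "F (\<lambda>_. u) (\<lambda>_. v) (\<lambda>_. w) (\<lambda>_. z) (0, 1) = T u v w z" for u v w z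
    by (subst assms) (simp_all add: smooth)
  assume L: ?L
  show ?R
  proof (intro allI)
    fix u v w z
    show "T u v w z = T v u w z \<and> T u v w z = T u w v z \<and> T u v w z = T u v z w"
      unfolding F[symmetric] using L unfolding totally_symmetric4_def
      by (simp add: vector_fields_iff smooth mem_normal_family)
  qed
next
  assume R: ?R
  show ?L
    unfolding totally_symmetric4_def
  proof (intro ballI)
    fix X Y Z W :: "(real \<times> real) vfield" and p
    assume "X \<in> vector_fields normal_family" "Y \<in> vector_fields normal_family"
      "Z \<in> vector_fields normal_family" "W \<in> vector_fields normal_family" "p \<in> normal_family"
    note * = this[unfolded vector_fields_iff mem_normal_family]
    show "F X Y Z W p = F Y X Z W p \<and> F X Y Z W p = F X Z Y W p \<and> F X Y Z W p = F X Y W Z p"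
      by (simp only: assms *) (use R in metis)
  qed
qed

lemma totally_symmetric3_frame_iff:
  assumes "\<And>X Y Z p. smooth_on normal_family X \<Longrightarrow> smooth_on normal_family Y \<Longrightarrow>
      smooth_on normal_family Z \<Longrightarrow> snd p > 0 \<Longrightarrow> F X Y Z p = (1 / snd p ^ n) *\<^sub>R T (X p) (Y p) (Z p)"
  shows "totally_symmetric3 normal_family F \<longleftrightarrow>
    (\<forall>u v w. T u v w = T v u w \<and> T u v w = (T u w v :: real \<times> real))"
    (is "?L \<longleftrightarrow> ?R")
proof
  have smooth: "smooth_on normal_family (\<lambda>_. u)" for u :: "real \<times> real"
    by (rule smooth_on_const[OF open_normal_family])
  have F: "F (\<lambda>_. u) (\<lambda>_. v) (\<lambda>_. w) (0, 1) = T u v w" for u v w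
    by (subst assms) (simp_all add: smooth)
  assume L: ?L
  show ?R
  proof (intro allI)
    fix u v w
    show "T u v w = T v u w \<and> T u v w = T u w v"
      unfolding F[symmetric] using L unfolding totally_symmetric3_def
      by (simp add: vector_fields_iff smooth mem_normal_family)
  qed
next
  assume R: ?R
  show ?L
    unfolding totally_symmetric3_def
  proof (intro ballI)
    fix X Y Z :: "(real \<times> real) vfield" and p
    assume "X \<in> vector_fields normal_family" "Y \<in> vector_fields normal_family"
      "Z \<in> vector_fields normal_family" "p \<in> normal_family"
    note * = this[unfolded vector_fields_iff mem_normal_family]
    show "F X Y Z p = F Y X Z p \<and> F X Y Z p = F X Z Y p"
      by (simp only: assms *) (use R in metis)
  qed
qed

subsection \<open>The Amari--Chentsov condition in components\<close>

lemmas frame_simps = frame_deriv_cubic_def frame_deriv_skew_def frame_curvature_def frame_metric_def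
  christoffel_def skew_def

lemma christoffel_amari_chentsov_iff:
  "(\<exists>\<alpha>. christoffel a b c d = christoffel 0 (2 * \<alpha>) 0 (8 * \<alpha>)) \<longleftrightarrow> a = 0 \<and> c = 0 \<and> d = 4 * b"
proof
  assume "\<exists>\<alpha>. christoffel a b c d = christoffel 0 (2 * \<alpha>) 0 (8 * \<alpha>)"
  then obtain \<alpha> where eq: "christoffel a b c d u v = christoffel 0 (2 * \<alpha>) 0 (8 * \<alpha>) u v" for u v
    by metis
  show "a = 0 \<and> c = 0 \<and> d = 4 * b"
    using eq[of "(1, 0)" "(1, 0)"] eq[of "(1, 0)" "(0, 1)"] eq[of "(0, 1)" "(0, 1)"]
    by (simp add: frame_simps)
next
  assume "a = 0 \<and> c = 0 \<and> d = 4 * b"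
  then show "\<exists>\<alpha>. christoffel a b c d = christoffel 0 (2 * \<alpha>) 0 (8 * \<alpha>)"
    \<comment> \<open>Forced by \<open>b = 2 * \<alpha>\<close>; then
      \<open>8 * \<alpha> = 4 * b\<close>.\<close>
    by (intro exI[of _ "b / 2"]) simp
qed

text \<open>As \<open>C\<close> is symmetric, only exchanging the direction with an argument imposes
  conditions. The derivative in direction \<open>(0, 1)\<close> vanishes, and the three exchanges
  say, up to factors, \<open>a - c = 0\<close>, \<open>4 * b - d = 0\<close> and
  \<open>c = 0\<close>.\<close>

lemma deriv_cubic_levi_civita_symmetric_iff:
  fixes a b c d :: real
  defines "T \<equiv> frame_deriv_cubic (christoffel 0 0 0 0) a b c d"
  shows "(\<forall>u v w z. T u v w z = T v u w z \<and> T u v w z = T u w v z \<and> T u v w z = T u v z w) \<longleftrightarrow>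
    a = 0 \<and> c = 0 \<and> d = 4 * b"
proof
  assume "\<forall>u v w z. T u v w z = T v u w z \<and> T u v w z = T u w v z \<and> T u v w z = T u v z w"
  then have T: "T u v w z = T v u w z" for u v w z by blast
  show "a = 0 \<and> c = 0 \<and> d = 4 * b"
    using T[of "(1, 0)" "(0, 1)" "(1, 0)" "(1, 0)"] T[of "(1, 0)" "(0, 1)" "(1, 0)" "(0, 1)"]
      T[of "(1, 0)" "(0, 1)" "(0, 1)" "(0, 1)"]
    by (simp add: T_def frame_simps)
next
  assume "a = 0 \<and> c = 0 \<and> d = 4 * b"
  \<comment> \<open>Only a multiple of the fourth power of the first coordinate form survives, which
    is visibly symmetric.\<close>
  then have "T u v w z = - 3 / 2 * b * fst u * fst v * fst w * fst z" for u v w z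
    by (simp add: T_def frame_simps field_simps)
  then show "\<forall>u v w z. T u v w z = T v u w z \<and> T u v w z = T u w v z \<and> T u v w z = T u v z w"
    by simp
qed

lemma skew_commute: "skew a b c d u v = skew a b c d v u"
  by (simp add: skew_def algebra_simps)

lemma frame_metric_commute: "frame_metric u v = frame_metric v u"
  by (simp add: frame_metric_def mult.commute)

lemma frame_metric_skew: "frame_metric (skew a b c d u v) w = frame_metric v (skew a b c d u w)"
  by (simp add: frame_metric_def skew_def field_simps)

text \<open>The correction term below is totally symmetric in \<open>u, v, w, z\<close>, which makes the conditions on
  \<open>\<nabla>C\<close> and on \<open>\<nabla>\<^sup>gC\<close> equivalent.\<close>

lemma deriv_cubic_christoffel:
  "frame_deriv_cubic (christoffel a b c d) a b c d u v w z = frame_deriv_cubic (christoffel 0 0 0 0) a b c d u v w z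
    + (frame_metric (skew a b c d u v) (skew a b c d w z) + frame_metric (skew a b c d u w) (skew a b c d v z)
    + frame_metric (skew a b c d u z) (skew a b c d v w)) / 2"
proof -
  interpret frame: bounded_bilinear frame_metric by (rule bounded_bilinear_frame_metric)
  interpret skew: bounded_bilinear "skew a b c d" by (rule bounded_bilinear_skew)
  have chr: "christoffel a b c d u v = christoffel 0 0 0 0 u v - (1 / 2) *\<^sub>R skew a b c d u v" for u v
    by (simp add: christoffel_def skew_def zero_prod_def[symmetric])
  \<comment> \<open>Symmetry and self-adjointness of \<open>K\<close> move each nested
    \<open>K\<close> across the metric.\<close>
  have *: "frame_metric (skew a b c d (skew a b c d u v) w) z = frame_metric (skew a b c d u v) (skew a b c d w z)"
    "frame_metric (skew a b c d v (skew a b c d u w)) z = frame_metric (skew a b c d u w) (skew a b c d v z)"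
    "frame_metric (skew a b c d v w) (skew a b c d u z) = frame_metric (skew a b c d u z) (skew a b c d v w)"
    by (simp_all only: skew_commute[of a b c d "skew a b c d u v"] frame_metric_skew[of a b c d w] frame_metric_skew[of a b c d v "skew a b c d u w"]
        frame_metric_commute[of "skew a b c d v w"])
  show ?thesis
    unfolding frame_deriv_cubic_def chr frame.diff_left frame.diff_right skew.diff_left skew.diff_right
      frame.scaleR_left frame.scaleR_right skew.scaleR_left skew.scaleR_right *
    by (simp add: field_simps)
qed

lemma deriv_cubic_symmetric_iff:
  fixes a b c d :: real
  defines "T \<equiv> frame_deriv_cubic (christoffel a b c d) a b c d"
  shows "(\<forall>u v w z. T u v w z = T v u w z \<and> T u v w z = T u w v z \<and> T u v w z = T u v z w) \<longleftrightarrow>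
    a = 0 \<and> c = 0 \<and> d = 4 * b"
proof -
  define Q where "Q u v w z = (frame_metric (skew a b c d u v) (skew a b c d w z)
    + frame_metric (skew a b c d u w) (skew a b c d v z)
    + frame_metric (skew a b c d u z) (skew a b c d v w)) / 2" for u v w z
  let ?L = "frame_deriv_cubic (christoffel 0 0 0 0) a b c d"
  have Q: "Q u v w z = Q v u w z" "Q u v w z = Q u w v z" "Q u v w z = Q u v z w" for u v w z
    unfolding Q_def
    by (simp_all add: skew_commute[of a b c d v u] skew_commute[of a b c d w v] skew_commute[of a b c d z w]
        frame_metric_commute[of "skew a b c d v w" "skew a b c d u z"]
        frame_metric_commute[of "skew a b c d v z" "skew a b c d u w"])
  have "?L u v w z + Q u v w z = ?L v u w z + Q v u w z \<longleftrightarrow> ?L u v w z = ?L v u w z"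
    "?L u v w z + Q u v w z = ?L u w v z + Q u w v z \<longleftrightarrow> ?L u v w z = ?L u w v z"
    "?L u v w z + Q u v w z = ?L u v z w + Q u v z w \<longleftrightarrow> ?L u v w z = ?L u v z w" for u v w z
    using Q(1)[of u v w z] Q(2)[of u v w z] Q(3)[of u v w z] by simp_all
  then show ?thesis
    unfolding T_def deriv_cubic_christoffel Q_def[symmetric] deriv_cubic_levi_civita_symmetric_iff[symmetric]
    by (simp only:)
qed

text \<open>\<open>\<nabla>\<^sup>gK\<close> is \<open>\<nabla>\<^sup>gC\<close> with an index
  raised, since \<open>g\<close> is parallel; the components of two vector equations contain the
  three scalar conditions.\<close>

lemma deriv_skew_symmetric_iff:
  fixes a b c d :: real
  defines "T \<equiv> frame_deriv_skew a b c d"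
  shows "(\<forall>u v w. T u v w = T v u w \<and> T u v w = T u w v) \<longleftrightarrow> a = 0 \<and> c = 0 \<and> d = 4 * b"
proof
  assume "\<forall>u v w. T u v w = T v u w \<and> T u v w = T u w v"
  then have T: "T u v w = T v u w" for u v w by blast
  show "a = 0 \<and> c = 0 \<and> d = 4 * b"
    using T[of "(1, 0)" "(0, 1)" "(1, 0)"] T[of "(1, 0)" "(0, 1)" "(0, 1)"]
    by (simp add: T_def frame_simps zero_prod_def)
next
  assume "a = 0 \<and> c = 0 \<and> d = 4 * b"
  then show "\<forall>u v w. T u v w = T v u w \<and> T u v w = T u w v"
    by (simp add: T_def frame_simps field_simps)
qed

text \<open>Duality changes \<open>K\<close> into \<open>-K\<close>, so terms quadratic in
  \<open>K\<close> agree. The difference of the curvatures is, up to sign,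
  \<open>\<nabla>\<^sup>gK\<close> antisymmetrized in its first two arguments, whence the same
  condition.\<close>

lemma curvature_eq_dual_iff:
  "(\<forall>u v w. frame_curvature (christoffel a b c d) u v w = frame_curvature (christoffel (-a) (-b) (-c) (-d)) u v w) \<longleftrightarrow>
    a = 0 \<and> c = 0 \<and> d = 4 * b"
proof
  assume "\<forall>u v w. frame_curvature (christoffel a b c d) u v w = frame_curvature (christoffel (-a) (-b) (-c) (-d)) u v w"
  then have R: "frame_curvature (christoffel a b c d) u v w = frame_curvature (christoffel (-a) (-b) (-c) (-d)) u v w"
    for u v w by blast
  show "a = 0 \<and> c = 0 \<and> d = 4 * b"
    using R[of "(1, 0)" "(0, 1)" "(1, 0)"] R[of "(1, 0)" "(0, 1)" "(0, 1)"]
    by (simp add: frame_simps field_simps)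
next
  assume "a = 0 \<and> c = 0 \<and> d = 4 * b"
  then show "\<forall>u v w. frame_curvature (christoffel a b c d) u v w = frame_curvature (christoffel (-a) (-b) (-c) (-d)) u v w"
    by (simp add: frame_simps field_simps)
qed

section \<open>Equivalence of the five statements\<close>

theorem theorem1:
  shows "(\<forall>p\<in>normal_family. \<forall>u v.
            fisher_metric p u v = (fst u * fst v + 2 * (snd u * snd v)) / (snd p)\<^sup>2) \<and>
    (\<exists>H :: (real \<times> real) monoid.
       carrier H = normal_family \<and> lie_group H \<and> left_invariant_metric H fisher_metric \<and>
       (\<forall>nab :: (real \<times> real) connection.
          statistical_lie_group H fisher_metric nab \<longrightarrow>
          (let G = normal_family;
               LC = levi_civita G fisher_metric;
               C = cubic_form fisher_metric nab;
               K = skewness G fisher_metric nab;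
               S1 = (\<exists>\<alpha>. \<forall>X\<in>vector_fields G. \<forall>Y\<in>vector_fields G. \<forall>p\<in>G.
                       nab X Y p = amari_chentsov \<alpha> X Y p);
               S2 = totally_symmetric4 G (cov_deriv_03 LC C);
               S3 = totally_symmetric4 G (cov_deriv_03 nab C);
               S4 = totally_symmetric3 G (cov_deriv_12 LC K);
               S5 = (\<forall>X\<in>vector_fields G. \<forall>Y\<in>vector_fields G. \<forall>Z\<in>vector_fields G. \<forall>p\<in>G.
                       curvature nab X Y Z p =
                       curvature (dual_connection G fisher_metric nab) X Y Z p)
           in (S1 \<longleftrightarrow> S2) \<and> (S1 \<longleftrightarrow> S3) \<and> (S1 \<longleftrightarrow> S4) \<and> (S1 \<longleftrightarrow> S5))))"
proof (intro conjI exI[of _ affine_group] allI impI)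
  show "\<forall>p\<in>normal_family. \<forall>u v. fisher_metric p u v = (fst u * fst v + 2 * (snd u * snd v)) / (snd p)\<^sup>2"
    by (simp add: fisher_metric_eq mem_normal_family)
  show "carrier affine_group = normal_family" "lie_group affine_group"
    "left_invariant_metric affine_group fisher_metric"
    by (simp_all add: lie_group_affine_group left_invariant_fisher_metric)
  fix nab :: "(real \<times> real) connection"
  assume "statistical_lie_group affine_group fisher_metric nab"
  then obtain a b c d where nab: "has_christoffel (christoffel a b c d) nab"
    by (rule statistical_has_christoffel)
  let ?G = normal_family and ?LC = "levi_civita normal_family fisher_metric"
  let ?dual = "dual_connection ?G fisher_metric nab"
  let ?cond = "a = 0 \<and> c = 0 \<and> d = 4 * b"
  have S1: "(\<exists>\<alpha>. \<forall>X\<in>vector_fields ?G. \<forall>Y\<in>vector_fields ?G. \<forall>p\<in>?G.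
      nab X Y p = amari_chentsov \<alpha> X Y p) \<longleftrightarrow> ?cond"
    by (simp only: has_christoffel_eq_iff[OF nab has_christoffel_amari_chentsov] christoffel_amari_chentsov_iff)
  have S2: "totally_symmetric4 ?G (cov_deriv_03 ?LC (cubic_form fisher_metric nab)) \<longleftrightarrow> ?cond"
    unfolding deriv_cubic_levi_civita_symmetric_iff[symmetric]
    by (rule totally_symmetric4_frame_iff[OF cov_deriv_cubic_form[OF nab has_christoffel_levi_civita]])
  have S3: "totally_symmetric4 ?G (cov_deriv_03 nab (cubic_form fisher_metric nab)) \<longleftrightarrow> ?cond"
    unfolding deriv_cubic_symmetric_iff[symmetric]
    by (rule totally_symmetric4_frame_iff[OF cov_deriv_cubic_form[OF nab nab]])
  have S4: "totally_symmetric3 ?G (cov_deriv_12 ?LC (skewness ?G fisher_metric nab)) \<longleftrightarrow> ?cond"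
    unfolding deriv_skew_symmetric_iff[symmetric]
    by (rule totally_symmetric3_frame_iff[OF cov_deriv_skewness[OF nab]])
  have S5: "(\<forall>X\<in>vector_fields ?G. \<forall>Y\<in>vector_fields ?G. \<forall>Z\<in>vector_fields ?G. \<forall>p\<in>?G.
      curvature nab X Y Z p = curvature ?dual X Y Z p) \<longleftrightarrow> ?cond"
    unfolding curvature_eq_dual_iff[symmetric] by (rule curvature_eq_frame_iff[OF nab has_christoffel_dual[OF nab]])
  show "let G = normal_family;
               LC = levi_civita G fisher_metric;
               C = cubic_form fisher_metric nab;
               K = skewness G fisher_metric nab;
               S1 = (\<exists>\<alpha>. \<forall>X\<in>vector_fields G. \<forall>Y\<in>vector_fields G. \<forall>p\<in>G.
                       nab X Y p = amari_chentsov \<alpha> X Y p);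
               S2 = totally_symmetric4 G (cov_deriv_03 LC C);
               S3 = totally_symmetric4 G (cov_deriv_03 nab C);
               S4 = totally_symmetric3 G (cov_deriv_12 LC K);
               S5 = (\<forall>X\<in>vector_fields G. \<forall>Y\<in>vector_fields G. \<forall>Z\<in>vector_fields G. \<forall>p\<in>G.
                       curvature nab X Y Z p =
                       curvature (dual_connection G fisher_metric nab) X Y Z p)
           in (S1 \<longleftrightarrow> S2) \<and> (S1 \<longleftrightarrow> S3) \<and> (S1 \<longleftrightarrow> S4) \<and> (S1 \<longleftrightarrow> S5)"
    unfolding Let_def S1 S2 S3 S4 S5 by simp
qed

end
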